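(* In the doubly infinite volume case $\ell=-\infty$, $\mathfrak r=\infty$ (that is, $\Lambda=\mathbb Z$), for every $n\in\mathbb Z$ the distribution $\underline\nu^n$ is the unique stationary distribution for the process on $\Omega^n$, and it is reversible.
   Context: Volume and states. The lattice is $\Lambda=\mathbb Z$, and $-\infty<\omega^{\min}\le0<\omega^{\max}<\infty$ are integers (finiteness is part of the model's assumptions when the volume is doubly infinite). Let $I=\{\omega^{\min},\dots,\omega^{\max}\}$. For $\underline z\in I^{\mathbb Z}$ put $N_{\mathrm p}(\underline z)=\sum_{i\le0}(z_i-\omega^{\min})$, $N_{\mathrm h}(\underline z)=\sum_{i\ge1}(\omega^{\max}-z_i)$, and let $\Omega=\{\underline z\in I^{\mathbb Z}:N_{\mathrm p}(\underline z)<\infty,\ N_{\mathrm h}(\underline z)<\infty\}$, a countable set. On $\Omega$ let $N(\underline z)=N_{\mathrm h}(\underline z)-N_{\mathrm p}(\underline z)\in\mathbb Z$ (conserved by the dynamics below), and $\Omega^n=\{\underline z\in\Omega:N(\underline z)=n\}$. Dynamics. $\underline z^{i,j}$ denotes $\underline z$ with $z_i$ decreased by one and $z_j$ increased by one. The process is the continuous-time Markov chain on $\Omega$ which, for each $i\in\mathbb Z$, jumps from $\underline z$ to $\underline z^{i,i+1}$ at rate $\mathfrak p(z_i,z_{i+1})$ and to $\underline z^{i+1,i}$ at rate $\mathfrak q(z_i,z_{i+1})$. Started in $\Omega^n$ it stays in $\Omega^n$; "the process on $\Omega^n$" is this restriction. The rates $\mathfrak p,\mathfrak q:I^2\to[0,\infty)$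 satisfy: (1) $\mathfrak p(\omega^{\min},\cdot)\equiv\mathfrak p(\cdot,\omega^{\max})\equiv\mathfrak q(\omega^{\max},\cdot)\equiv\mathfrak q(\cdot,\omega^{\min})\equiv0$, and all other values of $\mathfrak p,\mathfrak q$ are non-zero; (2) attractivity: whenever $y,z,z+1\in I$, $\mathfrak p(z+1,y)\ge\mathfrak p(z,y)$, $\mathfrak p(y,z+1)\le\mathfrak p(y,z)$, $\mathfrak q(y,z+1)\ge\mathfrak q(y,z)$, $\mathfrak q(z+1,y)\le\mathfrak q(z,y)$; (3) there are reals $\tfrac12<p=1-q\le1$ (by (1), $q>0$), a function $f:I\to[0,\infty)$ with $f(\omega^{\min})=0$, and a function $s:I\times I\to[0,\infty)$, extended by $s(\omega^{\max}+1,\cdot)=s(\cdot,\omega^{\max}+1)=0$, such that $\mathfrak p(y,z)=p\,s(y,z+1)f(y)$ and $\mathfrak q(y,z)=q\,s(y+1,z)f(z)$. Measures. For $z\in I$ let $f(z)!=\prod_{y=1}^zf(y)$ for $z>0$, $f(0)!=1$, and $f(z)!=1/\prod_{y=z+1}^0f(y)$ for $z<0$. For $\theta\in\mathbb R$ let $\mu^\theta(z)=\frac1{Z(\theta)}\frac{e^{\theta z}}{f(z)!}$, $z\in I$, with $Z(\theta)=\sum_{y\in I}\frac{e^{\theta y}}{f(y)!}$. For $c\in\mathbb R$ let $\theta_i=c+i(\ln p-\ln q)$ and $\underline\mu^c=\bigotimes_{i\in\mathbb Z}\mu^{\theta_i}$, which is concentrated on $\Omega$. Define $\underline\nu^n=\underline\mu^c(\,\cdot\mid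 N(\cdot)=n)$, a probability distribution on $\Omega^n$ (well defined and independent of the choice of $c\in\mathbb R$). *)

theory Defs
  imports "HOL-Probability.Probability"
begin

section \<open>Continuous-time Markov chains on a countable state space\<close>

definition exit_rate :: "'a set \<Rightarrow> ('a \<Rightarrow> 'a \<Rightarrow> real) \<Rightarrow> 'a \<Rightarrow> real" where
  "exit_rate S R x = (\<Sum>\<^sub>\<infinity>y\<in>S. R x y)"

text \<open>Feller's construction of the chain that jumps from \<open>x\<close> to \<open>y\<close> at rate \<open>R x y\<close>:
  \<open>ctmc_jumps S R m t x y\<close> is the probability that the chain started at \<open>x\<close> makes at most
  \<open>m\<close> jumps during the time interval from \<open>0\<close> to \<open>t\<close> and is at \<open>y\<close> at time \<open>t\<close>.  The
  integration variable \<open>u\<close> is the time of the first jump, which is exponential with parameter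
  \<open>exit_rate S R x\<close>.\<close>

primrec ctmc_jumps ::
  "'a set \<Rightarrow> ('a \<Rightarrow> 'a \<Rightarrow> real) \<Rightarrow> nat \<Rightarrow> real \<Rightarrow> 'a \<Rightarrow> 'a \<Rightarrow> ennreal"
where
  "ctmc_jumps S R 0 t x y =
     (if x = y then ennreal (exp (- exit_rate S R x * t)) else 0)"
| "ctmc_jumps S R (Suc m) t x y =
     (if x = y then ennreal (exp (- exit_rate S R x * t)) else 0) +
     (\<integral>\<^sup>+u\<in>{0..t}. ennreal (exp (- exit_rate S R x * u)) *
        (\<integral>\<^sup>+z. ennreal (R x z) * ctmc_jumps S R m (t - u) z y \<partial>count_space S) \<partial>lborel)"

text \<open>The transition function \<open>P\<^sub>t(x, y)\<close> of the chain with jump rates \<open>R\<close>, i.e. the minimal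
  nonnegative solution of Kolmogorov's backward equation.  Mass may only be lost by
  explosion.\<close>

definition ctmc_trans ::
  "'a set \<Rightarrow> ('a \<Rightarrow> 'a \<Rightarrow> real) \<Rightarrow> real \<Rightarrow> 'a \<Rightarrow> 'a \<Rightarrow> ennreal"
where
  "ctmc_trans S R t x y = (SUP m. ctmc_jumps S R m t x y)"

text \<open>Here \<open>S\<close> is a countable set that is closed under the dynamics with transition function
  \<open>P\<close>; distributions on \<open>S\<close> are probability measures on the power set of \<open>S\<close>.\<close>

definition stationary_distribution ::
  "'a set \<Rightarrow> (real \<Rightarrow> 'a \<Rightarrow> 'a \<Rightarrow> ennreal) \<Rightarrow> 'a measure \<Rightarrow> bool"
where
  "stationary_distribution S P \<pi> \<longleftrightarrow>
     prob_space \<pi> \<and> sets \<pi> = Pow S \<and>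
     (\<forall>t\<ge>0. \<forall>y\<in>S. (\<integral>\<^sup>+x. P t x y \<partial>\<pi>) = emeasure \<pi> {y})"

definition reversible_distribution ::
  "'a set \<Rightarrow> (real \<Rightarrow> 'a \<Rightarrow> 'a \<Rightarrow> ennreal) \<Rightarrow> 'a measure \<Rightarrow> bool"
where
  "reversible_distribution S P \<pi> \<longleftrightarrow>
     prob_space \<pi> \<and> sets \<pi> = Pow S \<and>
     (\<forall>t\<ge>0. \<forall>x\<in>S. \<forall>y\<in>S. emeasure \<pi> {x} * P t x y = emeasure \<pi> {y} * P t y x)"


section \<open>States\<close>

definition N_p :: "int \<Rightarrow> (int \<Rightarrow> int) \<Rightarrow> ennreal" where
  "N_p \<omega>min z = (\<integral>\<^sup>+i. ennreal (of_int (z i - \<omega>min)) \<partial>count_space {..0})"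

definition N_h :: "int \<Rightarrow> (int \<Rightarrow> int) \<Rightarrow> ennreal" where
  "N_h \<omega>max z = (\<integral>\<^sup>+i. ennreal (of_int (\<omega>max - z i)) \<partial>count_space {1..})"

definition \<Omega> :: "int \<Rightarrow> int \<Rightarrow> (int \<Rightarrow> int) set" where
  "\<Omega> \<omega>min \<omega>max =
     {z. (\<forall>i. z i \<in> {\<omega>min..\<omega>max}) \<and> N_p \<omega>min z < \<infinity> \<and> N_h \<omega>max z < \<infinity>}"

definition N_diff :: "int \<Rightarrow> int \<Rightarrow> (int \<Rightarrow> int) \<Rightarrow> real" where
  "N_diff \<omega>min \<omega>max z = enn2real (N_h \<omega>max z) - enn2real (N_p \<omega>min z)"

definition \<Omega>_level :: "int \<Rightarrow> int \<Rightarrow> int \<Rightarrow> (int \<Rightarrow> int) set" where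
  "\<Omega>_level \<omega>min \<omega>max n = {z \<in> \<Omega> \<omega>min \<omega>max. N_diff \<omega>min \<omega>max z = of_int n}"


section \<open>Dynamics\<close>

definition move :: "int \<Rightarrow> int \<Rightarrow> (int \<Rightarrow> int) \<Rightarrow> (int \<Rightarrow> int)" where
  "move i j z = z(i := z i - 1, j := z j + 1)"

text \<open>\<open>rp\<close> and \<open>rq\<close> are the rates of jumps to the right and to the left across a bond.\<close>

definition jump_rate ::
  "(int \<Rightarrow> int \<Rightarrow> real) \<Rightarrow> (int \<Rightarrow> int \<Rightarrow> real) \<Rightarrow> (int \<Rightarrow> int) \<Rightarrow> (int \<Rightarrow> int) \<Rightarrow> real"
where
  "jump_rate rp rq z z' =
     (\<Sum>\<^sub>\<infinity>i. (if z' = move i (i + 1) z then rp (z i) (z (i + 1)) else 0) +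
           (if z' = move (i + 1) i z then rq (z i) (z (i + 1)) else 0))"

definition process_trans ::
  "int \<Rightarrow> int \<Rightarrow> (int \<Rightarrow> int \<Rightarrow> real) \<Rightarrow> (int \<Rightarrow> int \<Rightarrow> real) \<Rightarrow>
   real \<Rightarrow> (int \<Rightarrow> int) \<Rightarrow> (int \<Rightarrow> int) \<Rightarrow> ennreal"
where
  "process_trans \<omega>min \<omega>max rp rq = ctmc_trans (\<Omega> \<omega>min \<omega>max) (jump_rate rp rq)"

text \<open>All functions are total on the integers, but only their values on \<open>{\<omega>min..\<omega>max}\<close>
  (for \<open>s\<close> also at \<open>\<omega>max + 1\<close>) are constrained and used.\<close>

locale blocking_model =
  fixes \<omega>min \<omega>max :: int
    and rp rq :: "int \<Rightarrow> int \<Rightarrow> real"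
    and p q :: real
    and f :: "int \<Rightarrow> real"
    and s :: "int \<Rightarrow> int \<Rightarrow> real"
  assumes range: "\<omega>min \<le> 0" "0 < \<omega>max"
    and rates_nonneg:
      "\<lbrakk>y \<in> {\<omega>min..\<omega>max}; z \<in> {\<omega>min..\<omega>max}\<rbrakk> \<Longrightarrow> 0 \<le> rp y z \<and> 0 \<le> rq y z"
    and rp_zero_iff:
      "\<lbrakk>y \<in> {\<omega>min..\<omega>max}; z \<in> {\<omega>min..\<omega>max}\<rbrakk> \<Longrightarrow> rp y z = 0 \<longleftrightarrow> y = \<omega>min \<or> z = \<omega>max"
    and rq_zero_iff:
      "\<lbrakk>y \<in> {\<omega>min..\<omega>max}; z \<in> {\<omega>min..\<omega>max}\<rbrakk> \<Longrightarrow> rq y z = 0 \<longleftrightarrow> y = \<omega>max \<or> z = \<omega>min"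
    and attractive:
      "\<lbrakk>y \<in> {\<omega>min..\<omega>max}; z \<in> {\<omega>min..\<omega>max}; z + 1 \<in> {\<omega>min..\<omega>max}\<rbrakk> \<Longrightarrow>
         rp (z + 1) y \<ge> rp z y \<and> rp y (z + 1) \<le> rp y z \<and>
         rq y (z + 1) \<ge> rq y z \<and> rq (z + 1) y \<le> rq z y"
    and asymmetry: "1 / 2 < p" "p \<le> 1" "p = 1 - q"
    and f_nonneg: "y \<in> {\<omega>min..\<omega>max} \<Longrightarrow> 0 \<le> f y"
    and f_min: "f \<omega>min = 0"
    and s_nonneg: "\<lbrakk>y \<in> {\<omega>min..\<omega>max}; z \<in> {\<omega>min..\<omega>max}\<rbrakk> \<Longrightarrow> 0 \<le> s y z"
    and s_boundary: "y \<in> {\<omega>min..\<omega>max} \<Longrightarrow> s (\<omega>max + 1) y = 0 \<and> s y (\<omega>max + 1) = 0"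
    and rp_eq:
      "\<lbrakk>y \<in> {\<omega>min..\<omega>max}; z \<in> {\<omega>min..\<omega>max}\<rbrakk> \<Longrightarrow> rp y z = p * s y (z + 1) * f y"
    and rq_eq:
      "\<lbrakk>y \<in> {\<omega>min..\<omega>max}; z \<in> {\<omega>min..\<omega>max}\<rbrakk> \<Longrightarrow> rq y z = q * s (y + 1) z * f z"


section \<open>Measures\<close>

definition f_fact :: "(int \<Rightarrow> real) \<Rightarrow> int \<Rightarrow> real" where
  "f_fact f z = (if z > 0 then \<Prod>y=1..z. f y
                 else if z = 0 then 1
                 else 1 / (\<Prod>y=z+1..0. f y))"

definition Z_norm :: "int \<Rightarrow> int \<Rightarrow> (int \<Rightarrow> real) \<Rightarrow> real \<Rightarrow> real" where
  "Z_norm \<omega>min \<omega>max f \<theta> = (\<Sum>y=\<omega>min..\<omega>max. exp (\<theta> * of_int y) / f_fact f y)"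

definition \<mu>_site :: "int \<Rightarrow> int \<Rightarrow> (int \<Rightarrow> real) \<Rightarrow> real \<Rightarrow> int measure" where
  "\<mu>_site \<omega>min \<omega>max f \<theta> =
     point_measure {\<omega>min..\<omega>max}
       (\<lambda>z. ennreal (1 / Z_norm \<omega>min \<omega>max f \<theta> * (exp (\<theta> * of_int z) / f_fact f z)))"

definition \<theta>_site :: "real \<Rightarrow> real \<Rightarrow> real \<Rightarrow> int \<Rightarrow> real" where
  "\<theta>_site p q c i = c + of_int i * (ln p - ln q)"

definition \<mu>_prod ::
  "int \<Rightarrow> int \<Rightarrow> real \<Rightarrow> real \<Rightarrow> (int \<Rightarrow> real) \<Rightarrow> real \<Rightarrow> (int \<Rightarrow> int) measure"
where
  "\<mu>_prod \<omega>min \<omega>max p q f c =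
     (\<Pi>\<^sub>M i\<in>UNIV. \<mu>_site \<omega>min \<omega>max f (\<theta>_site p q c i))"

text \<open>\<open>uniform_measure M A\<close> is the conditional measure of \<open>M\<close> given \<open>A\<close>.  Conditioning on
  \<open>N = n\<close> is conditioning on \<open>\<Omega>_level \<omega>min \<omega>max n\<close>; the result is then viewed as a measure
  on this countable set.\<close>

definition \<nu> ::
  "int \<Rightarrow> int \<Rightarrow> real \<Rightarrow> real \<Rightarrow> (int \<Rightarrow> real) \<Rightarrow> real \<Rightarrow> int \<Rightarrow> (int \<Rightarrow> int) measure"
where
  "\<nu> \<omega>min \<omega>max p q f c n =
     restrict_space
       (uniform_measure (\<mu>_prod \<omega>min \<omega>max p q f c) (\<Omega>_level \<omega>min \<omega>max n))
       (\<Omega>_level \<omega>min \<omega>max n)"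

end

theory Submission
  imports Defs
begin

text \<open>
  \<^bold>\<open>Reversibility.\<close>  The factorial weights satisfy \<open>\<mu>(y) f(y) = e\<^sup>\<theta> \<mu>(y - 1)\<close>, and raising \<open>\<theta>\<close> by
  \<open>ln p - ln q\<close> from one site to the next compensates the bias of the jumps.  A jump across a
  bond therefore balances the reversed jump as soon as the two sites of the bond are taken
  into account (\<open>bond_balance\<close>); all other factors of the product measure cancel.  In infinite
  volume the weight of a configuration is the limit of its weights in growing boxes, so
  detailed balance passes to the limit.  These limits are positive: under the tilt, the
  probability that site \<open>i\<close> deviates from the step configuration (\<open>\<omega>min\<close> on the left, \<open>\<omega>max\<close> on the
  right) decays exponentially in \<open>\<bar>i\<bar>\<close>.

  Detailed balance of the rates has to be lifted to the transition function.  Feller's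
  recursion splits a trajectory at its first jump; splitting it at its last jump gives the
  same numbers (\<open>forward_equation\<close>), because the two operations are convolutions with
  exponential functions on the two sides of the trajectory, and these commute.  Detailed
  balance turns one recursion into the other, and induction on the number of jumps gives
  \<open>detailed_balance_jumps\<close>.

  \<^bold>\<open>Stationarity.\<close>  A reversible distribution is stationary if no mass is lost by explosion.
  The exit rates are unbounded on \<open>\<Omega>\<close>, but they are at most linear in the number of sites at
  which the configuration deviates from the step, and a jump increases this number by at
  most 2.  A general criterion (\<open>honest\<close>) then bounds the expected number of jumps up to any
  time.

  \<^bold>\<open>Uniqueness.\<close>  Two configurations of the same level differ by a finitely supported current
  through the bonds.  Where this current is positive, some bond that carries it admits a jump
  which lowers it by one (\<open>ex_movable\<close>); hence every level is irreducible and
  all transition probabilities at time 1 are positive.  The pointwise minimum of two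
  stationary distributions is then invariant too, by conservation of mass.  At any given
  point it agrees with one of the two, and positivity spreads this agreement to all points
  (\<open>stationary_distribution_unique\<close>).
\<close>

section \<open>Convolutions on the half-line\<close>

lemma borel_measurable_countable_sum:
  fixes f :: "'i \<Rightarrow> 'a \<Rightarrow> ennreal"
  assumes "countable I" "\<And>i. i \<in> I \<Longrightarrow> f i \<in> borel_measurable M"
  shows "(\<lambda>x. \<integral>\<^sup>+i. f i x \<partial>count_space I) \<in> borel_measurable M"
proof -
  interpret sigma_finite_measure "count_space I"
    by (rule sigma_finite_measure_count_space_countable[OF assms(1)])
  have "(\<lambda>p. f (snd p) (fst p)) \<in> borel_measurable (M \<Otimes>\<^sub>M count_space I)"
    using assms by (intro measurable_compose_countable'[where f = "\<lambda>i p. f i (fst p)", OF _ measurable_snd assms(1)]) auto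
  then show ?thesis
    by (intro borel_measurable_nn_integral) (simp add: case_prod_unfold)
qed

text \<open>Convolution on the half-line, in the form in which Feller's recursion contains it; the
  recursion thereby becomes an algebraic identity between convolutions.\<close>

definition conv :: "(real \<Rightarrow> ennreal) \<Rightarrow> (real \<Rightarrow> ennreal) \<Rightarrow> real \<Rightarrow> ennreal" where
  "conv a g t = (\<integral>\<^sup>+u\<in>{0..t}. a u * g (t - u) \<partial>lborel)"

lemma conv_cong:
  "(\<And>u. 0 \<le> u \<Longrightarrow> u \<le> t \<Longrightarrow> g u = h u) \<Longrightarrow> conv a g t = conv a h t"
  unfolding conv_def by (intro nn_integral_cong) (auto split: split_indicator)

lemma conv_mono:
  "(\<And>u. 0 \<le> u \<Longrightarrow> u \<le> t \<Longrightarrow> g u \<le> h u) \<Longrightarrow> conv a g t \<le> conv a h t"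
  unfolding conv_def
  by (intro nn_integral_mono) (auto split: split_indicator intro!: mult_left_mono)

lemma conv_measurable [measurable]:
  assumes [measurable]: "a \<in> borel_measurable borel" "g \<in> borel_measurable borel"
  shows "conv a g \<in> borel_measurable borel"
proof -
  have "(\<lambda>t. \<integral>\<^sup>+u. a u * g (t - u) * (if 0 \<le> u \<and> u \<le> t then 1 else 0) \<partial>lborel)
          \<in> borel_measurable borel"
    by measurable
  then show ?thesis
    unfolding conv_def[abs_def] by (simp add: indicator_def)
qed

lemma conv_commute:
  assumes [measurable]: "a \<in> borel_measurable borel" "g \<in> borel_measurable borel"
  shows "conv a g t = conv g a t"
proof -
  have "conv a g t = (\<integral>\<^sup>+u. a (t + (-1) * u) * g (t - (t + (-1) * u)) * indicator {0..t} (t + (-1) * u) \<partial>lborel)"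
    unfolding conv_def by (subst nn_integral_real_affine[where c = "-1" and t = t]) auto
  also have "\<dots> = conv g a t"
    unfolding conv_def
    by (intro nn_integral_cong) (auto split: split_indicator simp: mult.commute)
  finally show ?thesis .
qed

text \<open>Both sides integrate \<open>a u * b v * g (t - u - v)\<close> over the triangle \<open>u, v \<ge> 0\<close>, \<open>u + v \<le> t\<close>.  By
  this identity splitting off the first jump of a trajectory commutes with splitting off the
  last one.\<close>

lemma conv_left_commute:
  assumes [measurable]: "a \<in> borel_measurable borel" "b \<in> borel_measurable borel"
    "g \<in> borel_measurable borel"
  shows "conv a (conv b g) t = conv b (conv a g) t"
proof -
  define F where "F u v = a u * b v * g (t - u - v) *
      (if 0 \<le> u \<and> 0 \<le> v \<and> u + v \<le> t then 1 else 0)" for u v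
  have [measurable]: "(\<lambda>(u, v). F u v) \<in> borel_measurable (lborel \<Otimes>\<^sub>M lborel)"
    unfolding F_def by measurable
  have eq: "(\<integral>\<^sup>+u. a' u * conv b' g (t - u) * indicator {0..t} u \<partial>lborel)
      = (\<integral>\<^sup>+u. (\<integral>\<^sup>+v. a' u * b' v * g (t - u - v) *
           (if 0 \<le> u \<and> 0 \<le> v \<and> u + v \<le> t then 1 else 0) \<partial>lborel) \<partial>lborel)"
    if [measurable]: "a' \<in> borel_measurable borel" "b' \<in> borel_measurable borel" for a' b'
    unfolding conv_def
    by (intro nn_integral_cong, subst nn_integral_cmult[symmetric], simp,
        subst nn_integral_multc[symmetric], simp, intro nn_integral_cong)
       (auto split: split_indicator simp: mult.assoc)
  have "conv a (conv b g) t = (\<integral>\<^sup>+u. (\<integral>\<^sup>+v. F u v \<partial>lborel) \<partial>lborel)"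
    unfolding F_def conv_def[of a] by (rule eq) measurable
  also have "\<dots> = (\<integral>\<^sup>+v. (\<integral>\<^sup>+u. F u v \<partial>lborel) \<partial>lborel)"
    by (rule lborel_pair.Fubini'[symmetric]) simp
  also have "\<dots> = (\<integral>\<^sup>+u. (\<integral>\<^sup>+v. b u * a v * g (t - u - v) *
           (if 0 \<le> u \<and> 0 \<le> v \<and> u + v \<le> t then 1 else 0) \<partial>lborel) \<partial>lborel)"
    unfolding F_def by (intro nn_integral_cong) (auto simp: algebra_simps)
  also have "\<dots> = conv b (conv a g) t"
    unfolding conv_def[of b] by (rule eq[symmetric]) measurable
  finally show ?thesis .
qed

lemma conv_cmult:
  assumes [measurable]: "a \<in> borel_measurable borel" "g \<in> borel_measurable borel"
  shows "conv a (\<lambda>u. c * g u) t = c * conv a g t"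
  unfolding conv_def
  by (subst nn_integral_cmult[symmetric]) (auto intro!: nn_integral_cong simp: mult_ac)

lemma conv_add:
  assumes [measurable]: "a \<in> borel_measurable borel" "g \<in> borel_measurable borel"
    "h \<in> borel_measurable borel"
  shows "conv a (\<lambda>u. g u + h u) t = conv a g t + conv a h t"
  unfolding conv_def
  by (subst nn_integral_add[symmetric]) (auto intro!: nn_integral_cong simp: distrib_left distrib_right)

lemma conv_countable_sum:
  assumes [measurable]: "a \<in> borel_measurable borel" and "countable S"
    and [measurable]: "\<And>z. z \<in> S \<Longrightarrow> g z \<in> borel_measurable borel"
  shows "conv a (\<lambda>u. \<integral>\<^sup>+z. g z u \<partial>count_space S) t = (\<integral>\<^sup>+z. conv a (g z) t \<partial>count_space S)"
proof -
  have "conv a (\<lambda>u. \<integral>\<^sup>+z. g z u \<partial>count_space S) t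
      = (\<integral>\<^sup>+u. (\<integral>\<^sup>+z. a u * g z (t - u) * indicator {0..t} u \<partial>count_space S) \<partial>lborel)"
    unfolding conv_def by (simp add: nn_integral_cmult nn_integral_multc)
  also have "\<dots> = (\<integral>\<^sup>+z. conv a (g z) t \<partial>count_space S)"
    unfolding conv_def by (rule nn_integral_count_space_nn_integral[OF assms(2)]) measurable
  finally show ?thesis .
qed

lemma conv_sum:
  assumes [measurable]: "a \<in> borel_measurable borel" "\<And>k. k \<in> I \<Longrightarrow> g k \<in> borel_measurable borel"
  shows "conv a (\<lambda>u. \<Sum>k\<in>I. g k u) t = (\<Sum>k\<in>I. conv a (g k) t)"
  unfolding conv_def
  by (subst nn_integral_sum[symmetric])
     (auto intro!: nn_integral_cong simp: sum_distrib_left sum_distrib_right)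

lemma conv_pos:
  assumes [measurable]: "a \<in> borel_measurable borel" "g \<in> borel_measurable borel"
    and pos: "\<And>u. 0 < a u" "\<And>u. 0 < u \<Longrightarrow> 0 < g u" and "0 < t"
  shows "0 < conv a g t"
proof (rule ccontr)
  assume "\<not> 0 < conv a g t"
  then have "AE u in lborel. a u * g (t - u) * indicator {0..t} u = 0"
    unfolding conv_def by (subst nn_integral_0_iff_AE[symmetric]) auto
  then have "AE u in lborel. indicator {0..<t} u = (0::ennreal)"
  proof eventually_elim
    case (elim u)
    show ?case
    proof (rule ccontr)
      assume "indicator {0..<t} u \<noteq> (0::ennreal)"
      then have "0 \<le> u" "u < t"
        by (auto split: split_indicator_asm)
      with elim have "a u = 0 \<or> g (t - u) = 0"
        by simp
      with pos(1)[of u] pos(2)[of "t - u"] \<open>u < t\<close> show False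
        by auto
    qed
  qed
  then have "(\<integral>\<^sup>+u. indicator {0..<t} u \<partial>lborel) = 0"
    by (subst nn_integral_0_iff_AE) auto
  with \<open>0 < t\<close> show False
    by simp
qed

text \<open>For \<open>b = 0\<close> this is the distribution function of the first jump time; for \<open>b > 0\<close> it shows how
  an exponentially growing bound is reproduced by one step of Feller's recursion.\<close>

lemma conv_exp:
  fixes a b t :: real
  assumes "0 \<le> t" "a + b > 0"
  shows "ennreal (a + b) * conv (\<lambda>u. ennreal (exp (- a * u))) (\<lambda>u. ennreal (exp (b * u))) t
    = ennreal (exp (b * t) - exp (- a * t))"
proof -
  have "ennreal (a + b) * conv (\<lambda>u. ennreal (exp (- a * u))) (\<lambda>u. ennreal (exp (b * u))) t
     = (\<integral>\<^sup>+u. ennreal ((a + b) * exp (b * t) * exp (- (a + b) * u)) * indicator {0..t} u \<partial>lborel)"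
    unfolding conv_def using assms(2)
    by (subst nn_integral_cmult[symmetric])
       (auto intro!: nn_integral_cong split: split_indicator
          simp: ennreal_mult'[symmetric] exp_add[symmetric] algebra_simps)
  also have "\<dots> = ennreal ((- exp (b * t) * exp (- (a + b) * t)) - (- exp (b * t) * exp (- (a + b) * 0)))"
  proof (rule nn_integral_FTC_Icc[OF _ _ _ assms(1)])
    show "((\<lambda>u. - exp (b * t) * exp (- (a + b) * u)) has_real_derivative
        (a + b) * exp (b * t) * exp (- (a + b) * u)) (at u)" for u
      by (auto intro!: derivative_eq_intros simp: algebra_simps)
  qed (use assms(2) in auto)
  also have "(- exp (b * t) * exp (- (a + b) * t)) - (- exp (b * t) * exp (- (a + b) * 0)) = exp (b * t) - exp (- a * t)"
    by (simp add: exp_add[symmetric] algebra_simps)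
  finally show ?thesis .
qed

section \<open>Sums over countable sets\<close>

lemma countable_sum_single:
  assumes "y \<in> S"
  shows "(\<integral>\<^sup>+z. (if z = y then F z else 0) \<partial>count_space S) = (F y :: ennreal)"
  using assms by (subst nn_integral_count_space'[where A = "{y}"]) auto

text \<open>The difference of the two functions is nonnegative and has integral zero.\<close>

lemma countable_sum_eqI:
  fixes g h :: "'a \<Rightarrow> ennreal"
  assumes "\<And>x. x \<in> S \<Longrightarrow> g x \<le> h x"
    and "(\<integral>\<^sup>+x. h x \<partial>count_space S) \<le> (\<integral>\<^sup>+x. g x \<partial>count_space S)"
    and "(\<integral>\<^sup>+x. g x \<partial>count_space S) \<noteq> \<infinity>"
    and "x \<in> S"
  shows "g x = h x"
proof (rule antisym)
  have "(\<integral>\<^sup>+x. h x - g x \<partial>count_space S)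
      = (\<integral>\<^sup>+x. h x \<partial>count_space S) - (\<integral>\<^sup>+x. g x \<partial>count_space S)"
    using assms by (intro nn_integral_diff) (auto simp: AE_count_space)
  also have "\<dots> = 0"
    using assms(2,3) by (simp add: diff_eq_0_iff_ennreal less_top)
  finally have "h x - g x = 0"
    using assms(4) by (simp add: nn_integral_0_iff_AE AE_count_space)
  then show "h x \<le> g x"
    by (simp add: diff_eq_0_iff_ennreal)
qed (use assms in auto)

lemma nn_integral_countable_measure:
  assumes "countable S" "sets \<pi> = Pow S"
  shows "(\<integral>\<^sup>+x. g x \<partial>\<pi>) = (\<integral>\<^sup>+x. emeasure \<pi> {x} * g x \<partial>count_space S)"
proof -
  have "\<pi> = density (count_space S) (\<lambda>x. emeasure \<pi> {x})"
  proof (rule measure_eqI_countable[OF assms(2) _ assms(1)])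
    fix x assume "x \<in> S"
    have "emeasure (density (count_space S) (\<lambda>x. emeasure \<pi> {x})) {x}
        = (\<integral>\<^sup>+y. emeasure \<pi> {y} * indicator {x} y \<partial>count_space S)"
      using \<open>x \<in> S\<close> by (intro emeasure_density) auto
    also have "\<dots> = (\<integral>\<^sup>+y. (if y = x then emeasure \<pi> {y} else 0) \<partial>count_space S)"
      by (intro nn_integral_cong) auto
    also have "\<dots> = emeasure \<pi> {x}"
      using \<open>x \<in> S\<close> by (rule countable_sum_single)
    finally show "emeasure \<pi> {x} = emeasure (density (count_space S) (\<lambda>x. emeasure \<pi> {x})) {x}"
      by simp
  qed simp
  then have "(\<integral>\<^sup>+x. g x \<partial>\<pi>) = (\<integral>\<^sup>+x. g x \<partial>density (count_space S) (\<lambda>x. emeasure \<pi> {x}))"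
    by simp
  also have "\<dots> = (\<integral>\<^sup>+x. emeasure \<pi> {x} * g x \<partial>count_space S)"
    by (rule nn_integral_density) auto
  finally show ?thesis .
qed

section \<open>Feller's construction: backward and forward equations\<close>

text \<open>A chain that cannot leave \<open>A\<close> is the chain on \<open>A\<close>.  This reduces the process on \<open>\<Omega>\<close>, started in
  a level of the conserved quantity, to a chain on that level.\<close>

lemma ctmc_jumps_closed_subset:
  assumes "A \<subseteq> S" and closed: "\<And>x z. x \<in> A \<Longrightarrow> z \<in> S - A \<Longrightarrow> R x z = 0" and "x \<in> A"
  shows "ctmc_jumps S R m t x y = ctmc_jumps A R m t x y"
proof -
  have exit: "exit_rate S R x = exit_rate A R x" if "x \<in> A" for x
    unfolding exit_rate_def using assms(1) closed[OF that]
    by (intro infsum_cong_neutral) auto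
  show ?thesis
    using \<open>x \<in> A\<close>
  proof (induction m arbitrary: x t)
    case 0
    then show ?case using exit[OF 0] by auto
  next
    case (Suc m)
    have "(\<integral>\<^sup>+z. ennreal (R x z) * ctmc_jumps S R m u z y \<partial>count_space S)
        = (\<integral>\<^sup>+z. ennreal (R x z) * ctmc_jumps S R m u z y \<partial>count_space A)" for u
      using assms(1) closed[OF \<open>x \<in> A\<close>] by (intro nn_integral_count_space_eq) auto
    also have "\<dots> u = (\<integral>\<^sup>+z. ennreal (R x z) * ctmc_jumps A R m u z y \<partial>count_space A)" for u
      by (intro nn_integral_cong) (simp add: Suc.IH)
    finally show ?case
      using exit[OF \<open>x \<in> A\<close>] by auto
  qed
qed

locale countable_chain =
  fixes S :: "'a set" and R :: "'a \<Rightarrow> 'a \<Rightarrow> real"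
  assumes countable: "countable S"
    and rate_nonneg: "\<lbrakk>x \<in> S; y \<in> S\<rbrakk> \<Longrightarrow> 0 \<le> R x y"
    and rate_summable: "x \<in> S \<Longrightarrow> R x summable_on S"
begin

abbreviation "r \<equiv> exit_rate S R"
abbreviation "J \<equiv> ctmc_jumps S R"
abbreviation "P \<equiv> ctmc_trans S R"

text \<open>The probability that the chain started at \<open>x\<close> does not jump up to time \<open>t\<close>.\<close>

definition hold :: "'a \<Rightarrow> real \<Rightarrow> ennreal" where
  "hold x t = ennreal (exp (- r x * t))"

lemma hold_measurable [measurable]: "hold x \<in> borel_measurable borel"
  unfolding hold_def[abs_def] by measurable

lemma exit_rate_nonneg: "x \<in> S \<Longrightarrow> 0 \<le> r x"
  unfolding exit_rate_def by (intro infsum_nonneg rate_nonneg)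

lemma ennreal_exit_rate:
  assumes "x \<in> S"
  shows "ennreal (r x) = (\<integral>\<^sup>+z. ennreal (R x z) \<partial>count_space S)"
proof -
  have "(\<lambda>y. norm (R x y)) summable_on S"
    using rate_summable[OF assms] rate_nonneg[OF assms]
    by (subst summable_on_cong[where g = "R x"]) auto
  then have abs: "Infinite_Set_Sum.abs_summable_on (R x) S"
    by (rule abs_summable_equivalent[THEN iffD1])
  then have "r x = infsetsum (R x) S"
    unfolding exit_rate_def
    by (simp add: infsetsum_infsum)
  then show ?thesis
    using nn_integral_conv_infsetsum[OF abs] rate_nonneg[OF assms] by simp
qed

lemma J_measurable:
  "x \<in> S \<Longrightarrow> (\<lambda>t. J m t x y) \<in> borel_measurable borel"
proof (induction m arbitrary: x)
  case 0
  have "(\<lambda>t. if x = y then hold x t else 0) \<in> borel_measurable borel"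
    by measurable
  then show ?case by (simp add: hold_def)
next
  case (Suc m)
  have [measurable]: "(\<lambda>u. \<integral>\<^sup>+z. ennreal (R x z) * J m u z y \<partial>count_space S)
      \<in> borel_measurable borel"
    using Suc.IH by (intro borel_measurable_countable_sum countable) auto
  have "(\<lambda>t. (if x = y then hold x t else 0)
      + conv (hold x) (\<lambda>u. \<integral>\<^sup>+z. ennreal (R x z) * J m u z y \<partial>count_space S) t)
      \<in> borel_measurable borel"
    by measurable
  then show ?case
    by (simp only: ctmc_jumps.simps hold_def conv_def)
qed

lemma conv_weighted_sum:
  assumes "\<And>z. z \<in> S \<Longrightarrow> g z \<in> borel_measurable borel"
  shows "conv (hold x) (\<lambda>u. \<integral>\<^sup>+z. c z * g z u \<partial>count_space S) t
    = (\<integral>\<^sup>+z. c z * conv (hold x) (g z) t \<partial>count_space S)"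
proof -
  have "conv (hold x) (\<lambda>u. \<integral>\<^sup>+z. c z * g z u \<partial>count_space S) t
      = (\<integral>\<^sup>+z. conv (hold x) (\<lambda>u. c z * g z u) t \<partial>count_space S)"
    using assms by (intro conv_countable_sum countable) auto
  also have "\<dots> = (\<integral>\<^sup>+z. c z * conv (hold x) (g z) t \<partial>count_space S)"
    using assms by (intro nn_integral_cong conv_cmult) auto
  finally show ?thesis .
qed

text \<open>Feller's recursion with the sum over the target of the first jump moved in front of the
  convolution.\<close>

lemma backward_equation:
  assumes "x \<in> S"
  shows "J (Suc m) t x y = (if x = y then hold x t else 0)
    + (\<integral>\<^sup>+z. ennreal (R x z) * conv (hold x) (\<lambda>u. J m u z y) t \<partial>count_space S)"
  using conv_weighted_sum[of "\<lambda>z u. J m u z y" x "\<lambda>z. ennreal (R x z)" t]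
  by (simp add: J_measurable hold_def conv_def)

text \<open>The decomposition at the last jump.  One jump is both first and last, which settles the
  base case by commutativity of the convolution.  In the induction step both sides expand to
  sums over the targets of the first jump and the origins of the last jump, with the two
  holding-time functions in opposite order.\<close>

lemma forward_equation:
  assumes "x \<in> S" "y \<in> S"
  shows "J (Suc m) t x y = (if x = y then hold y t else 0)
    + (\<integral>\<^sup>+z. ennreal (R z y) * conv (hold y) (\<lambda>u. J m u x z) t \<partial>count_space S)"
  using assms
proof (induction m arbitrary: x t)
  case 0
  have *: "c * conv a (\<lambda>u. if b then h u else 0) t = (if b then c * conv a h t else 0)"
    for c a h and b :: bool
    by (simp add: conv_def)
  have "(\<integral>\<^sup>+z. ennreal (R x z) * conv (hold x) (\<lambda>u. J 0 u z y) t \<partial>count_space S)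
      = (\<integral>\<^sup>+z. (if z = y then ennreal (R x z) * conv (hold x) (hold z) t else 0) \<partial>count_space S)"
    by (intro nn_integral_cong, simp only: ctmc_jumps.simps hold_def[symmetric] *)
  also have "\<dots> = ennreal (R x y) * conv (hold x) (hold y) t"
    by (rule countable_sum_single[OF \<open>y \<in> S\<close>])
  also have "\<dots> = ennreal (R x y) * conv (hold y) (hold x) t"
    by (simp add: conv_commute)
  also have "\<dots> = (\<integral>\<^sup>+z. (if z = x then ennreal (R z y) * conv (hold y) (hold x) t else 0) \<partial>count_space S)"
    by (rule countable_sum_single[OF \<open>x \<in> S\<close>, symmetric])
  also have "\<dots> = (\<integral>\<^sup>+z. ennreal (R z y) * conv (hold y) (\<lambda>u. J 0 u x z) t \<partial>count_space S)"
    by (intro nn_integral_cong)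
       (simp only: ctmc_jumps.simps hold_def[symmetric] * eq_commute[of x])
  finally show ?case
    unfolding backward_equation[OF \<open>x \<in> S\<close>] by (cases "x = y") simp_all
next
  case (Suc m)
  note [measurable] = J_measurable
  let ?two = "\<lambda>w z. ennreal (R x w) * (ennreal (R z y) * conv (hold x) (conv (hold y) (\<lambda>u. J m u w z)) t)"
  have cv_if: "conv a (\<lambda>u. if b then h u else 0) t = (if b then conv a h t else 0)"
    for a h and b :: bool
    by (simp add: conv_def)
  have mult_if: "c * (if b then d else 0) = (if b then c * d else 0)"
    for b and c d :: ennreal
    by simp
  have "(\<integral>\<^sup>+w. ennreal (R x w) * conv (hold x) (\<lambda>u. J (Suc m) u w y) t \<partial>count_space S)
      = (\<integral>\<^sup>+w. ennreal (R x w) * (if w = y then conv (hold x) (hold y) t else 0)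
          + (\<integral>\<^sup>+z. ?two w z \<partial>count_space S) \<partial>count_space S)"
  proof (intro nn_integral_cong)
    fix w assume "w \<in> space (count_space S)"
    then have w: "w \<in> S" by simp
    have "conv (hold x) (\<lambda>u. J (Suc m) u w y) t
        = conv (hold x) (\<lambda>u. if w = y then hold y u else 0) t
          + conv (hold x) (\<lambda>u. \<integral>\<^sup>+z. ennreal (R z y) * conv (hold y) (\<lambda>u. J m u w z) u \<partial>count_space S) t"
      using w by (subst conv_add[symmetric])
        (auto simp: Suc.IH[OF w \<open>y \<in> S\<close>] simp del: ctmc_jumps.simps
          intro!: borel_measurable_countable_sum countable)
    also have "conv (hold x) (\<lambda>u. \<integral>\<^sup>+z. ennreal (R z y) * conv (hold y) (\<lambda>u. J m u w z) u \<partial>count_space S) t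
        = (\<integral>\<^sup>+z. ennreal (R z y) * conv (hold x) (conv (hold y) (\<lambda>u. J m u w z)) t \<partial>count_space S)"
      using w by (intro conv_weighted_sum) auto
    finally show "ennreal (R x w) * conv (hold x) (\<lambda>u. J (Suc m) u w y) t
        = ennreal (R x w) * (if w = y then conv (hold x) (hold y) t else 0)
          + (\<integral>\<^sup>+z. ?two w z \<partial>count_space S)"
      by (simp add: distrib_left cv_if nn_integral_cmult)
  qed
  also have "\<dots> = ennreal (R x y) * conv (hold x) (hold y) t
      + (\<integral>\<^sup>+w. (\<integral>\<^sup>+z. ?two w z \<partial>count_space S) \<partial>count_space S)"
    using countable_sum_single[OF \<open>y \<in> S\<close>, of "\<lambda>w. ennreal (R x w) * conv (hold x) (hold y) t"]
    by (subst nn_integral_add) (auto simp: mult_if)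
  also have "(\<integral>\<^sup>+w. (\<integral>\<^sup>+z. ?two w z \<partial>count_space S) \<partial>count_space S)
      = (\<integral>\<^sup>+z. (\<integral>\<^sup>+w. ?two w z \<partial>count_space S) \<partial>count_space S)"
    by (rule nn_integral_count_space_nn_integral[OF countable]) simp
  also have "ennreal (R x y) * conv (hold x) (hold y) t
      + (\<integral>\<^sup>+z. (\<integral>\<^sup>+w. ?two w z \<partial>count_space S) \<partial>count_space S)
      = (\<integral>\<^sup>+z. ennreal (R z y) * (if x = z then conv (hold y) (hold x) t else 0)
          + (\<integral>\<^sup>+w. ?two w z \<partial>count_space S) \<partial>count_space S)"
    using countable_sum_single[OF \<open>x \<in> S\<close>, of "\<lambda>z. ennreal (R z y) * conv (hold y) (hold x) t"]
    by (subst nn_integral_add)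
       (auto simp: mult_if conv_commute[of "hold x"] eq_commute[of x])
  also have "\<dots> = (\<integral>\<^sup>+z. ennreal (R z y) * conv (hold y) (\<lambda>u. J (Suc m) u x z) t \<partial>count_space S)"
  proof (intro nn_integral_cong)
    fix z assume "z \<in> space (count_space S)"
    then have z: "z \<in> S" by simp
    have "conv (hold y) (\<lambda>u. J (Suc m) u x z) t
        = conv (hold y) (\<lambda>u. if x = z then hold x u else 0) t
          + conv (hold y) (\<lambda>u. \<integral>\<^sup>+w. ennreal (R x w) * conv (hold x) (\<lambda>u. J m u w z) u \<partial>count_space S) t"
      by (subst conv_add[symmetric])
        (auto simp: backward_equation[OF \<open>x \<in> S\<close>] simp del: ctmc_jumps.simps
          intro!: borel_measurable_countable_sum countable)
    also have "conv (hold y) (\<lambda>u. \<integral>\<^sup>+w. ennreal (R x w) * conv (hold x) (\<lambda>u. J m u w z) u \<partial>count_space S) t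
        = (\<integral>\<^sup>+w. ennreal (R x w) * conv (hold y) (conv (hold x) (\<lambda>u. J m u w z)) t \<partial>count_space S)"
      by (intro conv_weighted_sum) auto
    also have "\<dots> = (\<integral>\<^sup>+w. ennreal (R x w) * conv (hold x) (conv (hold y) (\<lambda>u. J m u w z)) t \<partial>count_space S)"
      by (intro nn_integral_cong) (simp add: conv_left_commute[of "hold y"])
    finally show "ennreal (R z y) * (if x = z then conv (hold y) (hold x) t else 0)
          + (\<integral>\<^sup>+w. ?two w z \<partial>count_space S)
        = ennreal (R z y) * conv (hold y) (\<lambda>u. J (Suc m) u x z) t"
      by (simp add: distrib_left cv_if nn_integral_cmult[symmetric] mult_ac del: nn_integral_cmult)
  qed
  finally show ?case
    unfolding backward_equation[OF \<open>x \<in> S\<close>, of "Suc m"]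
    by (cases "x = y") (simp_all del: ctmc_jumps.simps)
qed

text \<open>Multiplying by \<open>w x\<close> and exchanging \<open>w x * R x z\<close> for \<open>w z * R z x\<close> turns the backward equation
  from \<open>x\<close> to \<open>y\<close> into the forward equation from \<open>y\<close> to \<open>x\<close>.\<close>

lemma detailed_balance_jumps:
  assumes balance: "\<And>x y. x \<in> S \<Longrightarrow> y \<in> S \<Longrightarrow> w x * ennreal (R x y) = w y * ennreal (R y x)"
    and "x \<in> S" "y \<in> S"
  shows "w x * J m t x y = w y * J m t y x"
  using assms(2,3)
proof (induction m arbitrary: x y t)
  case 0
  then show ?case by simp
next
  case (Suc m)
  note [measurable] = J_measurable
  have "w x * (\<integral>\<^sup>+z. ennreal (R x z) * conv (hold x) (\<lambda>u. J m u z y) t \<partial>count_space S)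
      = (\<integral>\<^sup>+z. w x * ennreal (R x z) * conv (hold x) (\<lambda>u. J m u z y) t \<partial>count_space S)"
    by (simp add: nn_integral_cmult mult.assoc)
  also have "\<dots> = (\<integral>\<^sup>+z. w y * (ennreal (R z x) * conv (hold x) (\<lambda>u. J m u y z) t) \<partial>count_space S)"
  proof (intro nn_integral_cong)
    fix z assume "z \<in> space (count_space S)"
    then have z: "z \<in> S" by simp
    have "w x * ennreal (R x z) * conv (hold x) (\<lambda>u. J m u z y) t
        = ennreal (R z x) * conv (hold x) (\<lambda>u. w z * J m u z y) t"
      using z by (simp add: balance[OF \<open>x \<in> S\<close> z] conv_cmult mult_ac)
    also have "(\<lambda>u. w z * J m u z y) = (\<lambda>u. w y * J m u y z)"
      using Suc.IH[OF z \<open>y \<in> S\<close>] by blast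
    also have "ennreal (R z x) * conv (hold x) (\<lambda>u. w y * J m u y z) t
        = w y * (ennreal (R z x) * conv (hold x) (\<lambda>u. J m u y z) t)"
      using Suc.prems by (simp add: conv_cmult mult_ac)
    finally show "w x * ennreal (R x z) * conv (hold x) (\<lambda>u. J m u z y) t
        = w y * (ennreal (R z x) * conv (hold x) (\<lambda>u. J m u y z) t)" .
  qed
  also have "\<dots> = w y * (\<integral>\<^sup>+z. ennreal (R z x) * conv (hold x) (\<lambda>u. J m u y z) t \<partial>count_space S)"
    by (simp add: nn_integral_cmult)
  finally show ?case
    by (simp only: backward_equation[OF \<open>x \<in> S\<close>] forward_equation[OF \<open>y \<in> S\<close> \<open>x \<in> S\<close>] distrib_left)
       auto
qed

lemma detailed_balance_trans:
  assumes "\<And>x y. x \<in> S \<Longrightarrow> y \<in> S \<Longrightarrow> w x * ennreal (R x y) = w y * ennreal (R y x)"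
    and "x \<in> S" "y \<in> S"
  shows "w x * P t x y = w y * P t y x"
  unfolding ctmc_trans_def
  by (simp add: SUP_mult_left_ennreal detailed_balance_jumps[OF assms])

section \<open>Irreducible chains charge every state\<close>

text \<open>A path of \<open>m\<close> possible jumps can be completed in any positive amount of time.  The bound on
  the number of jumps does not depend on \<open>t\<close>, which the convolution in the induction step
  requires.\<close>

lemma jumps_pos:
  assumes "(\<lambda>x z. z \<in> S \<and> 0 < R x z)\<^sup>*\<^sup>* x y" "x \<in> S"
  shows "\<exists>m. \<forall>t>0. 0 < J m t x y"
  using assms
proof (induction rule: converse_rtranclp_induct)
  case base
  then show ?case
    by (intro exI[of _ 0]) simp
next
  case (step x z)
  then obtain m where m: "\<And>t. 0 < t \<Longrightarrow> 0 < J m t z y"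
    by auto
  have "0 < J (Suc m) t x y" if "0 < t" for t
  proof -
    have "0 < conv (hold x) (\<lambda>u. J m u z y) t"
      using step m that by (intro conv_pos) (auto simp: J_measurable hold_def)
    then have "0 < ennreal (R x z) * conv (hold x) (\<lambda>u. J m u z y) t"
      using step by (simp add: ennreal_zero_less_mult_iff)
    also have "\<dots> \<le> (\<integral>\<^sup>+z. ennreal (R x z) * conv (hold x) (\<lambda>u. J m u z y) t \<partial>count_space S)"
      using step by (intro nn_integral_ge_point) auto
    also have "\<dots> \<le> J (Suc m) t x y"
      unfolding backward_equation[OF \<open>x \<in> S\<close>] by simp
    finally show ?thesis .
  qed
  then show ?case by blast
qed

lemma trans_pos:
  assumes "(\<lambda>x z. z \<in> S \<and> 0 < R x z)\<^sup>*\<^sup>* x y" "x \<in> S" "0 < t"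
  shows "0 < P t x y"
proof -
  obtain m where "0 < J m t x y"
    using jumps_pos[OF assms(1,2)] \<open>0 < t\<close> by blast
  also have "\<dots> \<le> P t x y"
    unfolding ctmc_trans_def by (rule SUP_upper) simp
  finally show ?thesis .
qed

section \<open>Absence of explosion\<close>

lemma jumps_mono: "x \<in> S \<Longrightarrow> J m t x y \<le> J (Suc m) t x y"
proof (induction m arbitrary: x t)
  case 0
  then show ?case by simp
next
  case (Suc m)
  show ?case
    unfolding backward_equation[OF Suc.prems]
    by (intro add_mono order_refl nn_integral_mono mult_left_mono conv_mono Suc.IH) auto
qed

text \<open>The probability that the chain started at \<open>x\<close> makes at least \<open>m\<close> jumps up to time \<open>t\<close>, by
  decomposition at the first jump.\<close>

primrec many_jumps :: "nat \<Rightarrow> real \<Rightarrow> 'a \<Rightarrow> ennreal" where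
  "many_jumps 0 t x = 1"
| "many_jumps (Suc m) t x =
     (\<integral>\<^sup>+z. ennreal (R x z) * conv (hold x) (\<lambda>u. many_jumps m u z) t \<partial>count_space S)"

lemma many_jumps_measurable:
  "x \<in> S \<Longrightarrow> (\<lambda>t. many_jumps m t x) \<in> borel_measurable borel"
proof (induction m arbitrary: x)
  case (Suc m)
  note [measurable] = Suc.IH
  show ?case
    by (simp, intro borel_measurable_countable_sum countable) measurable
qed simp

lemma at_least_one_jump:
  assumes "x \<in> S" "0 \<le> t"
  shows "hold x t + many_jumps 1 t x = 1"
proof -
  have *: "many_jumps 1 t x = ennreal (r x) * conv (hold x) (\<lambda>_. 1) t"
    using ennreal_exit_rate[OF \<open>x \<in> S\<close>] by (simp add: nn_integral_multc)
  show ?thesis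
  proof (cases "r x = 0")
    case True
    then show ?thesis unfolding * by (simp add: hold_def)
  next
    case False
    then have "r x > 0"
      using exit_rate_nonneg[OF \<open>x \<in> S\<close>] by simp
    then have "many_jumps 1 t x = ennreal (1 - exp (- r x * t))"
      using conv_exp[of t "r x" 0] \<open>0 \<le> t\<close> unfolding * hold_def[abs_def] by simp
    then show ?thesis
      using \<open>r x > 0\<close> \<open>0 \<le> t\<close> by (simp add: hold_def ennreal_plus[symmetric] del: ennreal_plus)
  qed
qed

text \<open>Up to time \<open>t\<close> the chain makes either at most \<open>m\<close> jumps, and then is in some state, or at least
  \<open>m + 1\<close> jumps.\<close>

lemma jumps_mass:
  assumes "x \<in> S" "0 \<le> t"
  shows "(\<integral>\<^sup>+y. J m t x y \<partial>count_space S) + many_jumps (Suc m) t x = 1"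
  using assms
proof (induction m arbitrary: x t)
  case 0
  have "(\<integral>\<^sup>+y. J 0 t x y \<partial>count_space S) = (\<integral>\<^sup>+y. (if y = x then hold x t else 0) \<partial>count_space S)"
    by (intro nn_integral_cong) (auto simp: hold_def)
  also have "\<dots> = hold x t"
    using \<open>x \<in> S\<close> by (rule countable_sum_single)
  finally show ?case
    using at_least_one_jump[OF 0] by simp
next
  case (Suc m)
  note [measurable] = J_measurable many_jumps_measurable
  have "(\<integral>\<^sup>+y. J (Suc m) t x y \<partial>count_space S)
      = (\<integral>\<^sup>+y. (if y = x then hold x t else 0) \<partial>count_space S)
        + (\<integral>\<^sup>+y. (\<integral>\<^sup>+z. ennreal (R x z) * conv (hold x) (\<lambda>u. J m u z y) t \<partial>count_space S) \<partial>count_space S)"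
    unfolding backward_equation[OF \<open>x \<in> S\<close>] by (subst nn_integral_add) (auto simp: eq_commute)
  also have "(\<integral>\<^sup>+y. (if y = x then hold x t else 0) \<partial>count_space S) = hold x t"
    using \<open>x \<in> S\<close> by (rule countable_sum_single)
  also have "(\<integral>\<^sup>+y. (\<integral>\<^sup>+z. ennreal (R x z) * conv (hold x) (\<lambda>u. J m u z y) t \<partial>count_space S) \<partial>count_space S)
      = (\<integral>\<^sup>+z. (\<integral>\<^sup>+y. ennreal (R x z) * conv (hold x) (\<lambda>u. J m u z y) t \<partial>count_space S) \<partial>count_space S)"
    by (rule nn_integral_count_space_nn_integral[OF countable]) simp
  also have "\<dots> = (\<integral>\<^sup>+z. ennreal (R x z) * conv (hold x) (\<lambda>u. \<integral>\<^sup>+y. J m u z y \<partial>count_space S) t \<partial>count_space S)"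
    by (intro nn_integral_cong)
       (simp add: nn_integral_cmult conv_countable_sum[OF hold_measurable countable])
  finally have "(\<integral>\<^sup>+y. J (Suc m) t x y \<partial>count_space S) + many_jumps (Suc (Suc m)) t x
      = hold x t +
        ((\<integral>\<^sup>+z. ennreal (R x z) * conv (hold x) (\<lambda>u. \<integral>\<^sup>+y. J m u z y \<partial>count_space S) t \<partial>count_space S)
        + (\<integral>\<^sup>+z. ennreal (R x z) * conv (hold x) (\<lambda>u. many_jumps (Suc m) u z) t \<partial>count_space S))"
    by (simp only: many_jumps.simps add.assoc)
  also have "(\<integral>\<^sup>+z. ennreal (R x z) * conv (hold x) (\<lambda>u. \<integral>\<^sup>+y. J m u z y \<partial>count_space S) t \<partial>count_space S)
        + (\<integral>\<^sup>+z. ennreal (R x z) * conv (hold x) (\<lambda>u. many_jumps (Suc m) u z) t \<partial>count_space S)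
      = (\<integral>\<^sup>+z. ennreal (R x z) * conv (hold x) (\<lambda>u. (\<integral>\<^sup>+y. J m u z y \<partial>count_space S)
          + many_jumps (Suc m) u z) t \<partial>count_space S)"
    by (subst nn_integral_add[symmetric], simp, simp, intro nn_integral_cong)
       (simp add: conv_add borel_measurable_countable_sum[OF countable] distrib_left del: many_jumps.simps)
  also have "\<dots> = many_jumps 1 t x"
  proof -
    have "many_jumps 1 t x = (\<integral>\<^sup>+z. ennreal (R x z) * conv (hold x) (\<lambda>u. 1) t \<partial>count_space S)"
      by simp
    also have "\<dots> = (\<integral>\<^sup>+z. ennreal (R x z) * conv (hold x) (\<lambda>u. (\<integral>\<^sup>+y. J m u z y \<partial>count_space S)
          + many_jumps (Suc m) u z) t \<partial>count_space S)"
      by (intro nn_integral_cong arg_cong2[where f = "(*)"] refl conv_cong)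
         (simp add: Suc.IH del: many_jumps.simps)
    finally show ?thesis by simp
  qed
  finally show ?case
    using at_least_one_jump[OF Suc.prems] by simp
qed

text \<open>The left-hand side is the expectation of the number of jumps up to time \<open>t\<close>, truncated at \<open>m\<close>.
  It satisfies a recursion at the first jump in which every jump contributes \<open>1\<close>, and
  \<open>V x * exp (l * t)\<close> is a supersolution of this recursion if the growth rate \<open>l\<close> pays for the
  jump itself and for the increase \<open>a\<close> of \<open>V\<close>: both occur at rate \<open>r x \<le> b * V x\<close>, whence
  \<open>l = (1 + a) * b\<close>.\<close>

lemma many_jumps_sum_bound:
  fixes V :: "'a \<Rightarrow> real"
  assumes V_nonneg: "\<And>x. x \<in> S \<Longrightarrow> 0 \<le> V x"
    and growth: "\<And>x. x \<in> S \<Longrightarrow> r x \<le> b * V x" "0 < b"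
    and jump: "\<And>x z. x \<in> S \<Longrightarrow> z \<in> S \<Longrightarrow> 0 < R x z \<Longrightarrow> V z \<le> V x + a" "0 \<le> a"
    and "x \<in> S" "0 \<le> t"
  shows "(\<Sum>k<m. many_jumps (Suc k) t x) \<le> ennreal (V x * exp ((1 + a) * b * t))"
  using \<open>x \<in> S\<close> \<open>0 \<le> t\<close>
proof (induction m arbitrary: x t)
  case 0
  then show ?case by simp
next
  case (Suc m)
  note [measurable] = many_jumps_measurable
  \<comment> \<open>the exponential growth rate of the supersolution\<close>
  define l where "l = (1 + a) * b"
  have "l > 0" and [simp]: "0 \<le> V x"
    using growth(2) jump(2) V_nonneg \<open>x \<in> S\<close> by (auto simp: l_def)
  have e_meas: "(\<lambda>u. ennreal (exp (l * u))) \<in> borel_measurable borel"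
    by measurable
  \<comment> \<open>summing the recursion over \<open>k\<close>; the term \<open>k = 0\<close> below counts the first jump\<close>
  have "(\<Sum>k<Suc m. many_jumps (Suc k) t x)
      = (\<integral>\<^sup>+z. ennreal (R x z) * conv (hold x) (\<lambda>u. \<Sum>k<Suc m. many_jumps k u z) t \<partial>count_space S)"
    by (simp only: many_jumps.simps, subst nn_integral_sum[symmetric], simp, intro nn_integral_cong)
       (simp add: conv_sum sum_distrib_left del: sum.lessThan_Suc)
  also have "\<dots> \<le> (\<integral>\<^sup>+z. ennreal (R x z) * (ennreal (1 + a + V x) * conv (hold x) (\<lambda>u. ennreal (exp (l * u))) t) \<partial>count_space S)"
  proof (intro nn_integral_mono)
    fix z assume "z \<in> space (count_space S)"
    then have z: "z \<in> S" by simp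
    show "ennreal (R x z) * conv (hold x) (\<lambda>u. \<Sum>k<Suc m. many_jumps k u z) t
        \<le> ennreal (R x z) * (ennreal (1 + a + V x) * conv (hold x) (\<lambda>u. ennreal (exp (l * u))) t)"
    proof (cases "0 < R x z")
      case True
      have "conv (hold x) (\<lambda>u. \<Sum>k<Suc m. many_jumps k u z) t
          \<le> conv (hold x) (\<lambda>u. ennreal (1 + a + V x) * ennreal (exp (l * u))) t"
      proof (rule conv_mono)
        fix u assume "0 \<le> u" "u \<le> t"
        have "(\<Sum>k<Suc m. many_jumps k u z) = 1 + (\<Sum>k<m. many_jumps (Suc k) u z)"
          by (simp only: sum.lessThan_Suc_shift many_jumps.simps(1))
        also have "\<dots> \<le> ennreal 1 + ennreal (V z * exp (l * u))"
          using Suc.IH[OF z \<open>0 \<le> u\<close>] unfolding l_def by (intro add_mono) auto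
        also have "\<dots> = ennreal (1 + V z * exp (l * u))"
          using V_nonneg[OF z] by (subst ennreal_plus[symmetric]) auto
        also have "\<dots> \<le> ennreal ((1 + a + V x) * exp (l * u))"
        proof (rule ennreal_leI)
          have "1 + V z * exp (l * u) \<le> (1 + V z) * exp (l * u)"
            using \<open>l > 0\<close> \<open>0 \<le> u\<close> by (simp add: distrib_right)
          also have "\<dots> \<le> (1 + a + V x) * exp (l * u)"
            using jump(1)[OF \<open>x \<in> S\<close> z True] by (intro mult_right_mono) auto
          finally show "1 + V z * exp (l * u) \<le> (1 + a + V x) * exp (l * u)" .
        qed
        also have "\<dots> = ennreal (1 + a + V x) * ennreal (exp (l * u))"
          using jump(2) by (intro ennreal_mult) auto
        finally show "(\<Sum>k<Suc m. many_jumps k u z) \<le> ennreal (1 + a + V x) * ennreal (exp (l * u))" .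
      qed
      then show ?thesis
        by (simp add: conv_cmult[OF hold_measurable e_meas] mult_left_mono del: sum.lessThan_Suc)
    next
      case False
      then show ?thesis by (simp add: ennreal_neg)
    qed
  qed
  also have "\<dots> = ennreal (r x) * ennreal (1 + a + V x) * conv (hold x) (\<lambda>u. ennreal (exp (l * u))) t"
    by (simp add: ennreal_exit_rate[OF \<open>x \<in> S\<close>] nn_integral_multc mult.assoc)
  also have "ennreal (r x) * ennreal (1 + a + V x) = ennreal (r x * (1 + a + V x))"
    using exit_rate_nonneg[OF \<open>x \<in> S\<close>] jump(2) by (intro ennreal_mult[symmetric]) auto
  also have "ennreal (r x * (1 + a + V x)) * conv (hold x) (\<lambda>u. ennreal (exp (l * u))) t
      \<le> ennreal (V x * (r x + l)) * conv (hold x) (\<lambda>u. ennreal (exp (l * u))) t"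
    using mult_left_mono[OF growth(1)[OF \<open>x \<in> S\<close>], of "1 + a"] jump(2)
    by (intro mult_right_mono ennreal_leI) (auto simp: l_def algebra_simps)
  also have "\<dots> = ennreal (V x) * (ennreal (r x + l) * conv (hold x) (\<lambda>u. ennreal (exp (l * u))) t)"
    using exit_rate_nonneg[OF \<open>x \<in> S\<close>] \<open>l > 0\<close> by (subst ennreal_mult) (auto simp: mult.assoc)
  also have "ennreal (r x + l) * conv (hold x) (\<lambda>u. ennreal (exp (l * u))) t
      = ennreal (exp (l * t) - exp (- r x * t))"
    using conv_exp[of t "r x" l] exit_rate_nonneg[OF \<open>x \<in> S\<close>] \<open>l > 0\<close> \<open>0 \<le> t\<close>
    unfolding hold_def[abs_def] by simp
  also have "ennreal (V x) * \<dots> \<le> ennreal (V x * exp (l * t))"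
    by (subst ennreal_mult) (auto intro!: mult_left_mono ennreal_leI)
  finally show ?case
    by (simp only: l_def)
qed

text \<open>A criterion against explosion: the exit rate grows at most linearly in a function that
  increases by a bounded amount at each jump.  Since the expected number of jumps is finite,
  the probability of at least \<open>m\<close> jumps vanishes as \<open>m\<close> grows, and Feller's construction keeps
  the total mass.\<close>

lemma honest:
  fixes V :: "'a \<Rightarrow> real"
  assumes V_nonneg: "\<And>x. x \<in> S \<Longrightarrow> 0 \<le> V x"
    and growth: "\<And>x. x \<in> S \<Longrightarrow> r x \<le> b * V x" "0 < b"
    and jump: "\<And>x z. x \<in> S \<Longrightarrow> z \<in> S \<Longrightarrow> 0 < R x z \<Longrightarrow> V z \<le> V x + a" "0 \<le> a"
    and x: "x \<in> S" and t: "0 \<le> t"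
  shows "(\<integral>\<^sup>+y. P t x y \<partial>count_space S) = 1"
proof -
  define T where "T m = many_jumps (Suc m) t x" for m
  have mass: "(\<integral>\<^sup>+y. J m t x y \<partial>count_space S) + T m = 1" for m
    unfolding T_def by (rule jumps_mass[OF x t])
  then have "T m \<le> 1" for m
    by (metis add.commute le_iff_add)
  then have T: "T m = ennreal (enn2real (T m))" for m
    by (metis ennreal_enn2real ennreal_one_less_top order_le_less_trans)
  have bound: "(\<Sum>k<m. enn2real (T k)) \<le> V x * exp ((1 + a) * b * t)" for m
  proof -
    have "ennreal (\<Sum>k<m. enn2real (T k)) = (\<Sum>k<m. T k)"
      by (subst sum_ennreal[symmetric]) (auto simp: T[symmetric])
    also have "\<dots> \<le> ennreal (V x * exp ((1 + a) * b * t))"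
      unfolding T_def using assms by (intro many_jumps_sum_bound) auto
    finally show ?thesis
      using V_nonneg[OF x] by (subst (asm) ennreal_le_iff) auto
  qed
  have "summable (\<lambda>k. enn2real (T k))"
    using bound by (intro summableI_nonneg_bounded) auto
  then have "(\<lambda>k. ennreal (enn2real (T k))) \<longlonglongrightarrow> ennreal 0"
    by (intro tendsto_ennrealI summable_LIMSEQ_zero)
  then have T_lim: "T \<longlonglongrightarrow> 0"
    by (simp add: T[symmetric])
  have P_eq: "(\<integral>\<^sup>+y. P t x y \<partial>count_space S) = (SUP m. \<integral>\<^sup>+y. J m t x y \<partial>count_space S)"
    unfolding ctmc_trans_def
    by (intro nn_integral_monotone_convergence_SUP)
       (auto simp: incseq_Suc_iff le_fun_def intro!: jumps_mono[OF x] simp del: ctmc_jumps.simps)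
  have "1 \<le> (\<integral>\<^sup>+y. P t x y \<partial>count_space S) + T m" for m
    unfolding P_eq by (subst mass[of m, symmetric]) (intro add_mono SUP_upper order_refl, simp)
  moreover have "(\<lambda>m. (\<integral>\<^sup>+y. P t x y \<partial>count_space S) + T m)
      \<longlonglongrightarrow> (\<integral>\<^sup>+y. P t x y \<partial>count_space S) + 0"
    by (intro tendsto_add tendsto_const T_lim)
  ultimately have "1 \<le> (\<integral>\<^sup>+y. P t x y \<partial>count_space S) + 0"
    by (intro LIMSEQ_le_const) auto
  moreover have "(\<integral>\<^sup>+y. P t x y \<partial>count_space S) \<le> 1"
    unfolding P_eq using mass by (intro SUP_least) (metis le_iff_add)
  ultimately show ?thesis
    by (intro antisym) auto
qed

end

section \<open>Uniqueness of stationary distributions\<close>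

text \<open>The minimum \<open>m\<close> of the two distributions satisfies \<open>m P \<le> m\<close>, and both sides have the same
  finite mass, so \<open>m P = m\<close>.  At some point \<open>y\<close> it equals one of the two, say \<open>a\<close>; comparing the
  sums for \<open>m P\<close> and \<open>a P\<close> at \<open>y\<close> and using that all entries of \<open>P\<close> are positive, \<open>m = a\<close>
  everywhere.  Then one distribution lies below the other, and equal mass makes them equal.\<close>

lemma stationary_distribution_unique:
  fixes P :: "real \<Rightarrow> 'a \<Rightarrow> 'a \<Rightarrow> ennreal"
  assumes cnt: "countable S" and "0 \<le> t"
    and honest: "\<And>x. x \<in> S \<Longrightarrow> (\<integral>\<^sup>+y. P t x y \<partial>count_space S) = 1"
    and pos: "\<And>x y. x \<in> S \<Longrightarrow> y \<in> S \<Longrightarrow> 0 < P t x y"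
    and st: "stationary_distribution S P \<pi>" "stationary_distribution S P \<rho>"
  shows "\<pi> = \<rho>"
proof -
  define a b where "a x = emeasure \<pi> {x}" and "b x = emeasure \<rho> {x}" for x
  define m where "m x = min (a x) (b x)" for x
  have sets: "sets \<pi> = Pow S" "sets \<rho> = Pow S"
    and stat: "\<And>y. y \<in> S \<Longrightarrow> (\<integral>\<^sup>+x. a x * P t x y \<partial>count_space S) = a y"
       "\<And>y. y \<in> S \<Longrightarrow> (\<integral>\<^sup>+x. b x * P t x y \<partial>count_space S) = b y"
    using st \<open>0 \<le> t\<close> unfolding stationary_distribution_def a_def b_def
    by (auto simp: nn_integral_countable_measure[OF cnt, symmetric])
  have prob: "prob_space \<pi>" "prob_space \<rho>"
    using st unfolding stationary_distribution_def by auto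
  have total: "(\<integral>\<^sup>+x. a x \<partial>count_space S) = 1" "(\<integral>\<^sup>+x. b x \<partial>count_space S) = 1"
    using nn_integral_countable_measure[OF cnt sets(1), of "\<lambda>_. 1"]
      nn_integral_countable_measure[OF cnt sets(2), of "\<lambda>_. 1"] prob
    by (auto simp: a_def b_def prob_space.emeasure_space_1)
  have m_le: "m x \<le> a x" "m x \<le> b x" for x
    by (auto simp: m_def)
  have P_le: "P t x y \<le> 1" if "x \<in> S" "y \<in> S" for x y
    using nn_integral_ge_point[OF \<open>y \<in> S\<close>, of "P t x"] honest[OF \<open>x \<in> S\<close>] by simp
  have total_m: "(\<integral>\<^sup>+x. m x \<partial>count_space S) \<le> 1"
    using nn_integral_mono[of "count_space S" m a] m_le total by simp
  have mP: "(\<integral>\<^sup>+x. m x * P t x y \<partial>count_space S) = m y" if "y \<in> S" for y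
  proof (rule countable_sum_eqI[OF _ _ _ that, of "\<lambda>y. \<integral>\<^sup>+x. m x * P t x y \<partial>count_space S"])
    fix y assume "y \<in> S"
    show "(\<integral>\<^sup>+x. m x * P t x y \<partial>count_space S) \<le> m y"
      unfolding m_def[of y] stat(1)[OF \<open>y \<in> S\<close>, symmetric] stat(2)[OF \<open>y \<in> S\<close>, symmetric]
      by (auto intro!: nn_integral_mono mult_right_mono m_le)
  next
    have *: "(\<integral>\<^sup>+y. (\<integral>\<^sup>+x. m x * P t x y \<partial>count_space S) \<partial>count_space S)
        = (\<integral>\<^sup>+x. (\<integral>\<^sup>+y. m x * P t x y \<partial>count_space S) \<partial>count_space S)"
      by (rule nn_integral_count_space_nn_integral[OF cnt]) simp
    also have "\<dots> = (\<integral>\<^sup>+x. m x \<partial>count_space S)"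
      by (intro nn_integral_cong) (simp add: nn_integral_cmult honest)
    finally show "(\<integral>\<^sup>+y. m y \<partial>count_space S)
        \<le> (\<integral>\<^sup>+y. (\<integral>\<^sup>+x. m x * P t x y \<partial>count_space S) \<partial>count_space S)"
      and "(\<integral>\<^sup>+y. (\<integral>\<^sup>+x. m x * P t x y \<partial>count_space S) \<partial>count_space S) \<noteq> \<infinity>"
      using total_m by (auto simp: top_unique)
  qed
  \<comment> \<open>applied below with \<open>c\<close> one of \<open>a\<close>, \<open>b\<close>\<close>
  have coincide: "\<forall>x\<in>S. m x = c x"
    if "y \<in> S" "m y = c y" "(\<integral>\<^sup>+x. c x * P t x y \<partial>count_space S) = c y" "\<And>x. m x \<le> c x"
      "c y \<le> 1" for c y
  proof
    fix x assume "x \<in> S"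
    have "m x * P t x y = c x * P t x y"
    proof (rule countable_sum_eqI[OF _ _ _ \<open>x \<in> S\<close>])
      show "(\<integral>\<^sup>+x. m x * P t x y \<partial>count_space S) \<noteq> \<infinity>"
        using that mP[OF \<open>y \<in> S\<close>] by (auto simp: top_unique)
    qed (use that mP[OF \<open>y \<in> S\<close>] in \<open>auto intro!: mult_right_mono\<close>)
    moreover have "P t x y \<noteq> 0" "P t x y \<noteq> \<infinity>"
      using pos[OF \<open>x \<in> S\<close> \<open>y \<in> S\<close>] P_le[OF \<open>x \<in> S\<close> \<open>y \<in> S\<close>] by (auto simp: top_unique)
    ultimately show "m x = c x"
      by (metis mult_divide_eq_ennreal infinity_ennreal_def)
  qed
  have le_1: "a y \<le> 1" "b y \<le> 1" for y
    using prob by (auto simp: a_def b_def prob_space.emeasure_le_1)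
  have "\<forall>x\<in>S. a x = b x"
  proof (cases "S = {}")
    case False
    then obtain y where "y \<in> S" by auto
    have "m y = a y \<or> m y = b y"
      by (auto simp: m_def min_def)
    then consider "m y = a y" | "m y = b y"
      by blast
    then show ?thesis
    proof cases
      case 1
      then have "\<forall>x\<in>S. m x = a x"
        using coincide[OF \<open>y \<in> S\<close>, of a] stat \<open>y \<in> S\<close> m_le le_1 by auto
      then have "a x \<le> b x" if "x \<in> S" for x
        using that m_le(2)[of x] by auto
      then show ?thesis
        using countable_sum_eqI[of S a b] total by auto
    next
      case 2
      then have "\<forall>x\<in>S. m x = b x"
        using coincide[OF \<open>y \<in> S\<close>, of b] stat \<open>y \<in> S\<close> m_le le_1 by auto
      then have "b x \<le> a x" if "x \<in> S" for x
        using that m_le(1)[of x] by auto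
      then show ?thesis
        using countable_sum_eqI[of S b a] total by auto
    qed
  qed auto
  then show ?thesis
    using sets cnt by (intro measure_eqI_countable[where A = S]) (auto simp: a_def b_def)
qed

section \<open>Configurations and their conserved quantity\<close>

text \<open>A sum of nonnegative integers is finite only if almost all terms vanish.  This turns the
  conditions defining \<open>\<Omega>\<close> into combinatorial ones.\<close>

lemma nn_integral_int_finite_support:
  fixes g :: "int \<Rightarrow> int"
  assumes "\<And>i. i \<in> A \<Longrightarrow> 0 \<le> g i"
  shows "(\<integral>\<^sup>+i. ennreal (of_int (g i)) \<partial>count_space A) < \<infinity> \<longleftrightarrow> finite {i \<in> A. g i \<noteq> 0}"
    and "finite {i \<in> A. g i \<noteq> 0} \<Longrightarrow>
      enn2real (\<integral>\<^sup>+i. ennreal (of_int (g i)) \<partial>count_space A) = of_int (\<Sum>i | i \<in> A \<and> g i \<noteq> 0. g i)"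
proof -
  let ?D = "{i \<in> A. g i \<noteq> 0}"
  have val: "(\<integral>\<^sup>+i. ennreal (of_int (g i)) \<partial>count_space A) = ennreal (of_int (\<Sum>i\<in>?D. g i))"
    if "finite ?D"
  proof -
    have "(\<integral>\<^sup>+i. ennreal (of_int (g i)) \<partial>count_space A) = (\<Sum>i\<in>?D. ennreal (of_int (g i)))"
      using that by (intro nn_integral_count_space') auto
    also have "\<dots> = ennreal (\<Sum>i\<in>?D. of_int (g i))"
      using assms by (intro sum_ennreal) auto
    finally show ?thesis by simp
  qed
  show "enn2real (\<integral>\<^sup>+i. ennreal (of_int (g i)) \<partial>count_space A) = of_int (\<Sum>i\<in>?D. g i)"
    if "finite ?D"
    unfolding val[OF that] by (intro enn2real_ennreal) (auto intro!: sum_nonneg assms)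
  show "(\<integral>\<^sup>+i. ennreal (of_int (g i)) \<partial>count_space A) < \<infinity> \<longleftrightarrow> finite ?D"
  proof
    assume fin: "(\<integral>\<^sup>+i. ennreal (of_int (g i)) \<partial>count_space A) < \<infinity>"
    have "emeasure (count_space A) ?D = (\<integral>\<^sup>+i. indicator ?D i \<partial>count_space A)"
      by (subst nn_integral_indicator) auto
    also have "\<dots> \<le> (\<integral>\<^sup>+i. ennreal (of_int (g i)) \<partial>count_space A)"
    proof (intro nn_integral_mono)
      fix i assume "i \<in> space (count_space A)"
      then have "g i \<noteq> 0 \<longrightarrow> 1 \<le> g i"
        using assms[of i] by auto
      then show "indicator ?D i \<le> ennreal (of_int (g i))"
        by (auto split: split_indicator)
    qed
    finally show "finite ?D"
      using fin by (subst (asm) emeasure_count_space) (auto split: if_splits simp: top_unique)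
  qed (simp add: val)
qed

context blocking_model
begin

abbreviation "sites \<equiv> {\<omega>min..\<omega>max}"

abbreviation "level \<equiv> \<Omega>_level \<omega>min \<omega>max"

abbreviation "rate \<equiv> jump_rate rp rq"

text \<open>The ground state: the configuration with \<open>N\<^sub>p = N\<^sub>h = 0\<close>.\<close>

definition step :: "int \<Rightarrow> int" where
  "step i = (if i \<le> 0 then \<omega>min else \<omega>max)"

definition defects :: "(int \<Rightarrow> int) \<Rightarrow> int set" where
  "defects z = {i. z i \<noteq> step i}"

lemma \<omega>_less: "\<omega>min < \<omega>max"
  using range by linarith

lemma Omega_iff: "z \<in> \<Omega> \<omega>min \<omega>max \<longleftrightarrow> (\<forall>i. z i \<in> sites) \<and> finite (defects z)"
proof (cases "\<forall>i. z i \<in> sites")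
  case True
  have "N_p \<omega>min z < \<infinity> \<longleftrightarrow> finite {i \<in> {..0}. z i - \<omega>min \<noteq> 0}"
    unfolding N_p_def using True by (intro nn_integral_int_finite_support(1)) auto
  moreover have "N_h \<omega>max z < \<infinity> \<longleftrightarrow> finite {i \<in> {1..}. \<omega>max - z i \<noteq> 0}"
    unfolding N_h_def using True by (intro nn_integral_int_finite_support(1)) auto
  moreover have "defects z = {i \<in> {..0}. z i - \<omega>min \<noteq> 0} \<union> {i \<in> {1..}. \<omega>max - z i \<noteq> 0}"
    by (auto simp: defects_def step_def split: if_splits)
  ultimately show ?thesis
    using True by (simp add: \<Omega>_def)
next
  case False
  then show ?thesis
    unfolding \<Omega>_def by blast
qed

lemma N_diff_eq:
  assumes "z \<in> \<Omega> \<omega>min \<omega>max"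
  shows "N_diff \<omega>min \<omega>max z = of_int (\<Sum>i\<in>defects z. step i - z i)"
proof -
  let ?L = "{i \<in> {..0}. z i - \<omega>min \<noteq> 0}" and ?U = "{i \<in> {1..}. \<omega>max - z i \<noteq> 0}"
  have z: "\<forall>i. z i \<in> sites" and fin: "finite (defects z)"
    using assms by (auto simp: Omega_iff)
  have split: "defects z = ?L \<union> ?U"
    by (auto simp: defects_def step_def split: if_splits)
  then have fin': "finite ?L" "finite ?U"
    using fin by (auto intro: finite_subset)
  have "enn2real (N_p \<omega>min z) = of_int (\<Sum>i\<in>?L. z i - \<omega>min)"
    unfolding N_p_def using z fin'(1) by (intro nn_integral_int_finite_support(2)) auto
  moreover have "enn2real (N_h \<omega>max z) = of_int (\<Sum>i\<in>?U. \<omega>max - z i)"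
    unfolding N_h_def using z fin'(2) by (intro nn_integral_int_finite_support(2)) auto
  moreover have "(\<Sum>i\<in>defects z. step i - z i) = (\<Sum>i\<in>?L. step i - z i) + (\<Sum>i\<in>?U. step i - z i)"
    unfolding split by (intro sum.union_disjoint fin') auto
  moreover have "(\<Sum>i\<in>?L. step i - z i) = - (\<Sum>i\<in>?L. z i - \<omega>min)"
    by (subst sum_negf[symmetric]) (auto intro!: sum.cong simp: step_def)
  moreover have "(\<Sum>i\<in>?U. step i - z i) = (\<Sum>i\<in>?U. \<omega>max - z i)"
    by (auto intro!: sum.cong simp: step_def)
  ultimately show ?thesis
    by (simp add: N_diff_def)
qed

text \<open>The conserved quantity is the total deviation from the step configuration, a finite sum of
  integers.\<close>

lemma level_iff:
  "z \<in> level n \<longleftrightarrow>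
     (\<forall>i. z i \<in> sites) \<and> finite (defects z) \<and> (\<Sum>i\<in>defects z. step i - z i) = n"
  unfolding \<Omega>_level_def using N_diff_eq[of z] by (auto simp: Omega_iff simp del: of_int_sum)

lemma level_subset: "level n \<subseteq> \<Omega> \<omega>min \<omega>max"
  by (auto simp: \<Omega>_level_def)

lemma level_range: "z \<in> level n \<Longrightarrow> z i \<in> sites"
  by (auto simp: level_iff)

lemma finite_defects: "z \<in> level n \<Longrightarrow> finite (defects z)"
  by (auto simp: level_iff)

lemma sum_defects_superset:
  assumes "finite F" "defects z \<subseteq> F"
  shows "(\<Sum>i\<in>defects z. step i - z i) = (\<Sum>i\<in>F. step i - z i)"
  using assms by (intro sum.mono_neutral_left) (auto simp: defects_def)

text \<open>A configuration is determined by its values at the finitely many defects.\<close>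

lemma countable_level: "countable (level n)"
proof -
  let ?G = "\<lambda>z. (\<lambda>i. (i, z i)) ` defects z"
  have "inj_on ?G (level n)"
  proof (rule inj_onI)
    have sub: "z i = step i" if "?G z = ?G z'" "i \<notin> defects z'" for z z' :: "int \<Rightarrow> int" and i
    proof (rule ccontr)
      assume "z i \<noteq> step i"
      then have "(i, z i) \<in> ?G z" by (auto simp: defects_def)
      with that show False by auto
    qed
    fix z z' assume eq: "?G z = ?G z'"
    show "z = z'"
    proof
      fix i
      show "z i = z' i"
      proof (cases "i \<in> defects z'")
        case True
        then have "(i, z' i) \<in> ?G z" by (auto simp: eq)
        then show ?thesis by auto
      next
        case False
        then show ?thesis using sub[OF eq] by (simp add: defects_def)
      qed
    qed
  qed
  moreover have "countable (?G ` level n)"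
    by (rule countable_subset[OF _ countable_Collect_finite]) (auto simp: finite_defects)
  ultimately show ?thesis
    by (rule countable_image_inj_on[rotated])
qed

lemma level_nonempty: "level n \<noteq> {}"
proof (cases "n \<ge> 0")
  case True
  define z where "z i = (if 1 \<le> i \<and> i \<le> n then \<omega>max - 1 else step i)" for i
  have D: "defects z = {1..n}"
    by (auto simp: defects_def z_def step_def)
  have "(\<Sum>i\<in>defects z. step i - z i) = (\<Sum>i\<in>{1..n}. 1)"
    unfolding D by (intro sum.cong) (auto simp: z_def step_def)
  then have "z \<in> level n"
    using True range by (auto simp: level_iff D z_def step_def)
  then show ?thesis by auto
next
  case False
  define z where "z i = (if n < i \<and> i \<le> 0 then \<omega>min + 1 else step i)" for i
  have D: "defects z = {n<..0}"
    by (auto simp: defects_def z_def step_def)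
  have "(\<Sum>i\<in>defects z. step i - z i) = (\<Sum>i\<in>{n<..0}. - 1)"
    unfolding D by (intro sum.cong) (auto simp: z_def step_def)
  then have "z \<in> level n"
    using False range by (auto simp: level_iff D z_def step_def)
  then show ?thesis by auto
qed

lemma defects_move: "defects (move i j z) \<subseteq> insert i (insert j (defects z))"
  by (auto simp: defects_def move_def)

lemma move_level:
  assumes z: "z \<in> level n" and "i \<noteq> j" "z i \<noteq> \<omega>min" "z j \<noteq> \<omega>max"
  shows "move i j z \<in> level n"
proof -
  let ?F = "insert i (insert j (defects z))"
  have fin: "finite ?F"
    using finite_defects[OF z] by simp
  have "(\<Sum>k\<in>?F. step k - move i j z k)
      = (\<Sum>k\<in>?F. (step k - z k) + (if k = i then 1 else 0) - (if k = j then 1 else 0))"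
    using \<open>i \<noteq> j\<close> by (intro sum.cong) (auto simp: move_def)
  also have "\<dots> = (\<Sum>k\<in>?F. step k - z k)"
    using fin by (simp add: sum.distrib sum_subtractf del: sum.insert_if)
  finally have "(\<Sum>k\<in>?F. step k - move i j z k) = (\<Sum>k\<in>?F. step k - z k)" .
  then have "(\<Sum>k\<in>defects (move i j z). step k - move i j z k) = n"
    using sum_defects_superset[OF fin defects_move] sum_defects_superset[OF fin, of z] z
    by (simp add: level_iff subset_insertI2)
  moreover have "move i j z k \<in> sites" for k
    using assms level_range[OF z, of k] by (auto simp: move_def)
  ultimately show ?thesis
    using finite_subset[OF defects_move fin] by (auto simp: level_iff)
qed

section \<open>Jump rates of the blocking process\<close>

lemma move_right_inj: "move i (i + 1) z = move k (k + 1) z \<longleftrightarrow> i = k"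
  by (auto simp: move_def fun_eq_iff dest!: spec[of _ i] split: if_splits)

lemma move_left_inj: "move (i + 1) i z = move (k + 1) k z \<longleftrightarrow> i = k"
  by (auto simp: move_def fun_eq_iff dest!: spec[of _ i] split: if_splits)

lemma move_right_neq_left: "move i (i + 1) z \<noteq> move (k + 1) k z"
proof
  assume eq: "move i (i + 1) z = move (k + 1) k z"
  have "i = k + 1"
    using fun_cong[OF eq, of i] by (auto simp: move_def split: if_splits)
  moreover have "i + 1 = k"
    using fun_cong[OF eq, of "i + 1"] by (auto simp: move_def split: if_splits)
  ultimately show False by simp
qed

text \<open>Different bonds, and different directions across a bond, lead to different configurations,
  so that a single summand of \<open>jump_rate\<close> survives; likewise for jumps to the left.\<close>

lemma rate_right: "rate z (move i (i + 1) z) = rp (z i) (z (i + 1))"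
proof -
  have "rate z (move i (i + 1) z) = (\<Sum>\<^sub>\<infinity>k\<in>{i}. rp (z k) (z (k + 1)))"
    unfolding jump_rate_def
    by (intro infsum_cong_neutral) (auto simp: move_right_inj move_right_neq_left)
  then show ?thesis by simp
qed

lemma rate_left: "rate z (move (i + 1) i z) = rq (z i) (z (i + 1))"
proof -
  have "rate z (move (i + 1) i z) = (\<Sum>\<^sub>\<infinity>k\<in>{i}. rq (z k) (z (k + 1)))"
    unfolding jump_rate_def
    by (intro infsum_cong_neutral)
       (auto simp: move_left_inj move_right_neq_left[symmetric])
  then show ?thesis by simp
qed

lemma rate_cases:
  assumes "rate z z' \<noteq> 0" and z: "\<And>i. z i \<in> sites"
  obtains (right) i where "z' = move i (i + 1) z" "z i \<noteq> \<omega>min" "z (i + 1) \<noteq> \<omega>max"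
    | (left) i where "z' = move (i + 1) i z" "z i \<noteq> \<omega>max" "z (i + 1) \<noteq> \<omega>min"
proof -
  have "\<exists>i. z' = move i (i + 1) z \<or> z' = move (i + 1) i z"
  proof (rule ccontr)
    assume "\<nexists>i. z' = move i (i + 1) z \<or> z' = move (i + 1) i z"
    then have "rate z z' = 0"
      unfolding jump_rate_def by (intro infsum_0) auto
    with assms show False by simp
  qed
  then obtain i where "z' = move i (i + 1) z \<or> z' = move (i + 1) i z" by auto
  then show ?thesis
  proof
    assume "z' = move i (i + 1) z"
    with assms(1) show ?thesis
      using rp_zero_iff[OF z z, of i "i + 1"] by (intro right[of i]) (auto simp: rate_right)
  next
    assume "z' = move (i + 1) i z"
    with assms(1) show ?thesis
      using rq_zero_iff[OF z z, of i "i + 1"] by (intro left[of i]) (auto simp: rate_left)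
  qed
qed

text \<open>A bound for all rates that is also positive, as a growth constant has to be.\<close>

definition max_rate :: real where
  "max_rate = 1 + (\<Sum>y\<in>sites. \<Sum>z\<in>sites. rp y z + rq y z)"

lemma rates_le_max:
  assumes "y \<in> sites" "z \<in> sites"
  shows "rp y z \<le> max_rate" "rq y z \<le> max_rate"
proof -
  have "rp y z + rq y z \<le> (\<Sum>z\<in>sites. rp y z + rq y z)"
    using assms rates_nonneg
    by (intro member_le_sum[of z sites "\<lambda>z. rp y z + rq y z"]) auto
  also have "\<dots> \<le> (\<Sum>y\<in>sites. \<Sum>z\<in>sites. rp y z + rq y z)"
    using assms rates_nonneg
    by (intro member_le_sum[of y sites "\<lambda>y. \<Sum>z\<in>sites. rp y z + rq y z"]) (auto intro!: sum_nonneg)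
  finally show "rp y z \<le> max_rate" "rq y z \<le> max_rate"
    using rates_nonneg[OF assms] by (auto simp: max_rate_def)
qed

lemma max_rate_pos: "0 < max_rate"
  unfolding max_rate_def using rates_nonneg
  by (intro add_pos_nonneg sum_nonneg) auto

lemma rate_bounds:
  assumes z: "\<And>i. z i \<in> sites"
  shows "0 \<le> rate z z'" "rate z z' \<le> max_rate"
proof -
  have "0 \<le> rate z z' \<and> rate z z' \<le> max_rate"
  proof (cases "rate z z' = 0")
    case True
    then show ?thesis using max_rate_pos by simp
  next
    case False
    then show ?thesis
      using z
    proof (cases rule: rate_cases)
      case (right i)
      then show ?thesis
        using rates_nonneg[OF z z] rates_le_max[OF z z] by (simp add: rate_right)
    next
      case (left i)
      then show ?thesis
        using rates_nonneg[OF z z] rates_le_max[OF z z] by (simp add: rate_left)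
    qed
  qed
  then show "0 \<le> rate z z'" "rate z z' \<le> max_rate" by auto
qed

lemma rate_stays_in_level:
  assumes "z \<in> level n" "rate z z' \<noteq> 0"
  shows "z' \<in> level n"
  using assms(2) level_range[OF assms(1)]
  by (cases rule: rate_cases) (use assms(1) in \<open>auto intro!: move_level\<close>)

text \<open>Bond \<open>i\<close> joins \<open>i\<close> and \<open>i + 1\<close>.  It can be crossed only if one of its ends is a defect, except
  for bond \<open>0\<close>, where the step itself permits a jump to the left.\<close>

definition active_bonds :: "(int \<Rightarrow> int) \<Rightarrow> int set" where
  "active_bonds z = insert 0 (defects z \<union> (\<lambda>i. i - 1) ` defects z)"

lemma rate_support:
  assumes "\<And>i. z i \<in> sites"
  shows "{z'. rate z z' \<noteq> 0} \<subseteq>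
    (\<lambda>i. move i (i + 1) z) ` active_bonds z \<union> (\<lambda>i. move (i + 1) i z) ` active_bonds z"
proof
  have active: "i \<in> active_bonds z" if "i = 0 \<or> z i \<noteq> step i \<or> z (i + 1) \<noteq> step (i + 1)" for i
    using that by (auto simp: active_bonds_def defects_def image_iff intro!: bexI[of _ "i + 1"])
  fix z' assume "z' \<in> {z'. rate z z' \<noteq> 0}"
  then have "rate z z' \<noteq> 0" by simp
  then show "z' \<in> (\<lambda>i. move i (i + 1) z) ` active_bonds z \<union> (\<lambda>i. move (i + 1) i z) ` active_bonds z"
    using assms
  proof (cases rule: rate_cases)
    case (right i)
    then have "i \<in> active_bonds z"
      by (intro active) (auto simp: step_def)
    with right show ?thesis by auto
  next
    case (left i)
    then have "i \<in> active_bonds z"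
      by (intro active) (auto simp: step_def)
    with left show ?thesis by auto
  qed
qed

lemma card_rate_support:
  assumes z: "z \<in> level n"
  shows "finite {z'. rate z z' \<noteq> 0}"
    and "card {z'. rate z z' \<noteq> 0} \<le> 4 * (1 + card (defects z))"
proof -
  have fin: "finite (active_bonds z)"
    using finite_defects[OF z] by (simp add: active_bonds_def)
  note sup = rate_support[of z, OF level_range[OF z]]
  show "finite {z'. rate z z' \<noteq> 0}"
    by (rule finite_subset[OF sup]) (use fin in auto)
  have "card (active_bonds z) \<le> Suc (card (defects z \<union> (\<lambda>i. i - 1) ` defects z))"
    unfolding active_bonds_def by (rule card_insert_le_m1) auto
  also have "card (defects z \<union> (\<lambda>i. i - 1) ` defects z) \<le> card (defects z) + card ((\<lambda>i. i - 1) ` defects z)"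
    by (rule card_Un_le)
  also have "card ((\<lambda>i. i - 1) ` defects z) \<le> card (defects z)"
    by (rule card_image_le[OF finite_defects[OF z]])
  finally have card: "card (active_bonds z) \<le> 1 + 2 * card (defects z)"
    by simp
  have "card {z'. rate z z' \<noteq> 0}
      \<le> card ((\<lambda>i. move i (i + 1) z) ` active_bonds z \<union> (\<lambda>i. move (i + 1) i z) ` active_bonds z)"
    by (rule card_mono[OF _ sup]) (use fin in auto)
  also have "\<dots> \<le> card (active_bonds z) + card (active_bonds z)"
    by (rule order_trans[OF card_Un_le add_mono]) (intro card_image_le fin)+
  finally show "card {z'. rate z z' \<noteq> 0} \<le> 4 * (1 + card (defects z))"
    using card by simp
qed

lemma level_chain: "countable_chain (level n) rate"
proof
  show "countable (level n)" by (rule countable_level)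
  show "0 \<le> rate x y" if "x \<in> level n" for x y
    by (rule rate_bounds(1)[OF level_range[OF that]])
  show "rate x summable_on level n" if "x \<in> level n" for x
    by (rule finite_nonzero_values_imp_summable_on)
       (rule finite_subset[OF _ card_rate_support(1)[OF that]], auto)
qed

lemma exit_rate_bound:
  assumes z: "z \<in> level n"
  shows "exit_rate (level n) rate z \<le> 4 * max_rate * (1 + real (card (defects z)))"
proof -
  let ?N = "{z'. rate z z' \<noteq> 0}"
  have "exit_rate (level n) rate z = (\<Sum>\<^sub>\<infinity>z'\<in>?N. rate z z')"
    unfolding exit_rate_def
    by (intro infsum_cong_neutral) (auto intro: rate_stays_in_level[OF z])
  also have "\<dots> = (\<Sum>z'\<in>?N. rate z z')"
    by (rule infsum_finite[OF card_rate_support(1)[OF z]])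
  also have "\<dots> \<le> real (card ?N) * max_rate"
    by (rule sum_bounded_above) (rule rate_bounds(2)[OF level_range[OF z]])
  also have "\<dots> \<le> real (4 * (1 + card (defects z))) * max_rate"
    by (intro mult_right_mono of_nat_mono card_rate_support(2)[OF z]) (use max_rate_pos in auto)
  finally show ?thesis
    by (simp add: algebra_simps)
qed

lemma card_defects_jump:
  assumes z: "z \<in> level n" and "rate z z' \<noteq> 0"
  shows "card (defects z') \<le> card (defects z) + 2"
proof -
  have "card (defects (move i j z)) \<le> card (defects z) + 2" for i j
  proof -
    have "card (defects (move i j z)) \<le> card (insert i (insert j (defects z)))"
      using finite_defects[OF z] by (intro card_mono defects_move) auto
    also have "\<dots> \<le> card (defects z) + 2"
      using finite_defects[OF z] by (auto simp: card_insert_if)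
    finally show ?thesis .
  qed
  note le = this
  show ?thesis
    using assms(2) level_range[OF z] by (cases rule: rate_cases) (simp_all only: le)
qed

text \<open>The number of defects controls the exit rate, since each jump crosses an active bond, and
  grows by at most 2 in a jump, since a jump changes two sites.\<close>

lemma level_honest:
  assumes "z \<in> level n" "0 \<le> t"
  shows "(\<integral>\<^sup>+y. ctmc_trans (level n) rate t z y \<partial>count_space (level n)) = 1"
proof -
  interpret countable_chain "level n" rate by (rule level_chain)
  show ?thesis
  proof (rule honest[where V = "\<lambda>z. 1 + real (card (defects z))" and b = "4 * max_rate" and a = 2])
    show "1 + real (card (defects y)) \<le> 1 + real (card (defects x)) + 2"
      if "x \<in> level n" "0 < rate x y" for x y
      using card_defects_jump[OF that(1), of y] that(2) by simp
  qed (use assms exit_rate_bound max_rate_pos in auto)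
qed

lemma process_trans_level:
  "x \<in> level n \<Longrightarrow> process_trans \<omega>min \<omega>max rp rq t x y = ctmc_trans (level n) rate t x y"
  unfolding process_trans_def ctmc_trans_def
  by (intro SUP_cong refl ctmc_jumps_closed_subset level_subset)
     (auto dest: rate_stays_in_level)

section \<open>Irreducibility on each level\<close>

definition jumps_to :: "int \<Rightarrow> (int \<Rightarrow> int) \<Rightarrow> (int \<Rightarrow> int) \<Rightarrow> bool" where
  "jumps_to n x z \<longleftrightarrow> z \<in> level n \<and> 0 < rate x z"

text \<open>Every possible jump can be undone, so it suffices to consider jumps to the right in order
  to connect configurations.\<close>

lemma jump_right:
  assumes x: "x \<in> level n" and "x i \<noteq> \<omega>min" "x (i + 1) \<noteq> \<omega>max"
  defines "x' \<equiv> move i (i + 1) x"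
  shows "x' \<in> level n" "jumps_to n x x'" "jumps_to n x' x"
proof -
  show x': "x' \<in> level n"
    unfolding x'_def using assms by (intro move_level) auto
  have sites: "x i \<in> sites" "x (i + 1) \<in> sites" "x' i \<in> sites" "x' (i + 1) \<in> sites"
    using level_range[OF x] level_range[OF x'] by blast+
  have "rate x x' \<noteq> 0"
    unfolding x'_def rate_right using rp_zero_iff[OF sites(1,2)] assms by simp
  then show "jumps_to n x x'"
    using x' rate_bounds(1)[of x x', OF level_range[OF x]] by (simp add: jumps_to_def)
  have "x = move (i + 1) i x'"
    by (auto simp: x'_def move_def fun_eq_iff)
  moreover have "rate x' (move (i + 1) i x') \<noteq> 0"
    unfolding rate_left using rq_zero_iff[OF sites(3,4)] sites(1,2) 
    by (auto simp: x'_def move_def)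
  ultimately show "jumps_to n x' x"
    using x rate_bounds(1)[of x' x, OF level_range[OF x']] by (simp add: jumps_to_def)
qed

text \<open>Start at the leftmost bond \<open>a\<close> with positive current.  The current increases there, so \<open>x\<close>
  exceeds \<open>y\<close> at \<open>a\<close>, and site \<open>a\<close> has a particle to give.  If its right neighbour cannot accept
  one, then \<open>x\<close> is maximal there, so the current does not decrease and the neighbour in turn
  has a particle to give.  If this never ended, the current would be positive on a half-line.\<close>

lemma ex_movable:
  fixes d :: "int \<Rightarrow> int"
  assumes "finite {k. 0 < d k}" "0 < d k0"
    and x: "\<And>i. x i \<in> sites" and y: "\<And>i. y i \<in> sites"
    and diff: "\<And>i. x i - y i = d i - d (i - 1)"
  shows "\<exists>k. 0 < d k \<and> x k \<noteq> \<omega>min \<and> x (k + 1) \<noteq> \<omega>max"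
proof (rule ccontr)
  assume none: "\<nexists>k. 0 < d k \<and> x k \<noteq> \<omega>min \<and> x (k + 1) \<noteq> \<omega>max"
  define a where "a = Min {k. 0 < d k}"
  have a: "0 < d a" "\<And>k. 0 < d k \<Longrightarrow> a \<le> k"
    using Min_in[OF assms(1)] Min_le[OF assms(1)] assms(2) by (auto simp: a_def)
  have "0 < d (a + int j) \<and> x (a + int j) \<noteq> \<omega>min" for j
  proof (induction j)
    case 0
    have "d (a - 1) \<le> 0"
      using a(2)[of "a - 1"] by force
    then have "y a < x a"
      using a(1) diff[of a] by simp
    then show ?case
      using a(1) y[of a] by auto
  next
    case (Suc j)
    then have "x (a + int j + 1) = \<omega>max"
      using none by blast
    moreover have "y (a + int j + 1) \<le> \<omega>max"
      using y[of "a + int j + 1"] by simp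
    ultimately have "d (a + int j) \<le> d (a + int j + 1)"
      using diff[of "a + int j + 1"] by simp
    then show ?case
      using Suc \<open>x (a + int j + 1) = \<omega>max\<close> \<omega>_less by (simp add: algebra_simps)
  qed
  then have "range (\<lambda>j. a + int j) \<subseteq> {k. 0 < d k}"
    by auto
  moreover have "infinite (range (\<lambda>j. a + int j))"
    by (intro range_inj_infinite) (auto simp: inj_def)
  ultimately show False
    using assms(1) finite_subset by blast
qed

text \<open>Here \<open>d k\<close> is the net number of particles that has to cross bond \<open>k\<close> to turn \<open>x\<close> into \<open>y\<close>.  A
  positive current is lowered by a jump of \<open>x\<close>; a negative one is raised by a jump of \<open>y\<close>, which
  is then traversed backwards.\<close>

lemma reachable_via_current:
  fixes d :: "int \<Rightarrow> int"
  assumes "finite G" "\<And>k. k \<notin> G \<Longrightarrow> d k = 0"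
    and "x \<in> level n" "y \<in> level n"
    and "\<And>i. x i - y i = d i - d (i - 1)"
  shows "(jumps_to n)\<^sup>*\<^sup>* x y"
  using assms(2-)
proof (induction "nat (\<Sum>k\<in>G. \<bar>d k\<bar>)" arbitrary: d x y rule: less_induct)
  case less
  note supp = less.prems(1) and x = less.prems(2) and y = less.prems(3) and diff = less.prems(4)
  have sub: "{k. d k \<noteq> 0} \<subseteq> G"
    using supp by blast
  have smaller: "nat (\<Sum>k\<in>G. \<bar>d' k\<bar>) < nat (\<Sum>k\<in>G. \<bar>d k\<bar>)"
    if "d k \<noteq> 0" "\<bar>d' k\<bar> < \<bar>d k\<bar>" "\<And>j. j \<noteq> k \<Longrightarrow> d' j = d j" for d' :: "int \<Rightarrow> int" and k
  proof -
    have "k \<in> G" using that(1) sub by blast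
    have "(\<Sum>k\<in>G. \<bar>d' k\<bar>) < (\<Sum>k\<in>G. \<bar>d k\<bar>)"
    proof (rule sum_strict_mono_ex1[OF assms(1)])
      show "\<forall>j\<in>G. \<bar>d' j\<bar> \<le> \<bar>d j\<bar>"
        using that(2,3) by (metis order_less_imp_le order_refl)
    qed (use \<open>k \<in> G\<close> that(2) in auto)
    moreover have "0 \<le> (\<Sum>k\<in>G. \<bar>d' k\<bar>)"
      by (intro sum_nonneg) auto
    ultimately show ?thesis by linarith
  qed
  consider (pos) k where "0 < d k" | (neg) k where "d k < 0" | (zero) "\<And>k. d k = 0"
    by (metis linorder_less_linear)
  then show ?case
  proof cases
    case pos
    have "finite {k. 0 < d k}"
      by (rule finite_subset[OF _ assms(1)]) (use sub in auto)
    then obtain k where k: "0 < d k" "x k \<noteq> \<omega>min" "x (k + 1) \<noteq> \<omega>max"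
      using ex_movable[OF _ pos level_range[OF x] level_range[OF y] diff] by blast
    note jump = jump_right[OF x k(2,3)]
    have "(jumps_to n)\<^sup>*\<^sup>* (move k (k + 1) x) y"
    proof (rule less.hyps[of "d(k := d k - 1)"])
      show "nat (\<Sum>j\<in>G. \<bar>(d(k := d k - 1)) j\<bar>) < nat (\<Sum>k\<in>G. \<bar>d k\<bar>)"
        using k(1) by (intro smaller[of k]) auto
      show "(d(k := d k - 1)) j = 0" if "j \<notin> G" for j
        using that supp[OF that] k(1) by auto
      show "move k (k + 1) x i - y i = (d(k := d k - 1)) i - (d(k := d k - 1)) (i - 1)" for i
        using diff[of i] diff[of "k + 1"] by (auto simp: move_def)
    qed (use jump y in auto)
    with jump(2) show ?thesis
      by (rule converse_rtranclp_into_rtranclp)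
  next
    case neg
    have "finite {k. 0 < - d k}"
      by (rule finite_subset[OF _ assms(1)]) (use sub in auto)
    then obtain k where k: "0 < - d k" "y k \<noteq> \<omega>min" "y (k + 1) \<noteq> \<omega>max"
      using ex_movable[where d = "\<lambda>k. - d k" and x = y and y = x and ?k0.0 = k] neg diff
        level_range[OF y] level_range[OF x] by (smt (verit))
    note jump = jump_right[OF y k(2,3)]
    have "(jumps_to n)\<^sup>*\<^sup>* x (move k (k + 1) y)"
    proof (rule less.hyps[of "d(k := d k + 1)"])
      show "nat (\<Sum>j\<in>G. \<bar>(d(k := d k + 1)) j\<bar>) < nat (\<Sum>k\<in>G. \<bar>d k\<bar>)"
        using k(1) by (intro smaller[of k]) auto
      show "(d(k := d k + 1)) j = 0" if "j \<notin> G" for j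
        using that supp[OF that] k(1) by auto
      show "x i - move k (k + 1) y i = (d(k := d k + 1)) i - (d(k := d k + 1)) (i - 1)" for i
        using diff[of i] diff[of "k + 1"] by (auto simp: move_def)
    qed (use jump x in auto)
    with jump(3) show ?thesis
      by (rule rtranclp.rtrancl_into_rtrancl[rotated])
  next
    case zero
    then have "x = y"
      using diff by (intro ext) simp
    then show ?thesis by simp
  qed
qed

text \<open>The current through bond \<open>k\<close> is the surplus of \<open>x\<close> over \<open>y\<close> up to site \<open>k\<close>.  It vanishes far to
  the right precisely because both configurations have the same value of the conserved
  quantity.\<close>

lemma level_irreducible:
  assumes x: "x \<in> level n" and y: "y \<in> level n"
  shows "(jumps_to n)\<^sup>*\<^sup>* x y"
proof -
  define F where "F = defects x \<union> defects y"
  have fin: "finite F"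
    using finite_defects[OF x] finite_defects[OF y] by (simp add: F_def)
  have eq: "x i = y i" if "i \<notin> F" for i
    using that by (auto simp: F_def defects_def)
  define L U where "L = Min (insert 0 F)" and "U = Max (insert 0 F)"
  have LU: "L \<le> i" "i \<le> U" if "i \<in> F" for i
    using fin that by (auto simp: L_def U_def)
  define d where "d k = (\<Sum>i | i \<in> F \<and> i \<le> k. x i - y i)" for k
  have total: "(\<Sum>i\<in>F. x i - y i) = 0"
  proof -
    have "(\<Sum>i\<in>F. step i - x i) = n" "(\<Sum>i\<in>F. step i - y i) = n"
      using x y sum_defects_superset[OF fin, of x] sum_defects_superset[OF fin, of y]
      by (auto simp: level_iff F_def)
    then show ?thesis by (simp add: sum_subtractf)
  qed
  show ?thesis
  proof (rule reachable_via_current[of "{L..U}"])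
    fix k assume "k \<notin> {L..U}"
    then consider "k < L" | "U < k" by fastforce
    then show "d k = 0"
    proof cases
      case 1
      then have "{i. i \<in> F \<and> i \<le> k} = {}"
        using LU by fastforce
      then show ?thesis unfolding d_def by (simp only: sum.empty)
    next
      case 2
      then have "{i. i \<in> F \<and> i \<le> k} = F"
        using LU by fastforce
      then show ?thesis using total by (simp add: d_def)
    qed
  next
    fix i
    show "x i - y i = d i - d (i - 1)"
    proof (cases "i \<in> F")
      case True
      then have "{j. j \<in> F \<and> j \<le> i} = insert i {j. j \<in> F \<and> j \<le> i - 1}"
        by auto
      then show ?thesis
        using fin by (simp add: d_def)
    next
      case False
      then have "{j. j \<in> F \<and> j \<le> i} = {j. j \<in> F \<and> j \<le> i - 1}"
        by (auto simp: order_le_less)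
      then show ?thesis
        using eq[OF False] by (simp add: d_def)
    qed
  qed (use x y in auto)
qed

lemma level_trans_pos:
  assumes "x \<in> level n" "y \<in> level n" "0 < t"
  shows "0 < ctmc_trans (level n) rate t x y"
proof -
  interpret countable_chain "level n" rate by (rule level_chain)
  show ?thesis
    using level_irreducible[OF assms(1,2)] assms unfolding jumps_to_def[abs_def]
    by (intro trans_pos)
qed

section \<open>Detailed balance of the product measure\<close>

text \<open>The value \<open>f y\<close> is a factor of the rate of a jump from a site with value \<open>y\<close> to a right
  neighbour with value \<open>\<omega>min\<close>, and that rate is nonzero.\<close>

lemma f_pos:
  assumes "y \<in> sites" "y \<noteq> \<omega>min"
  shows "0 < f y"
proof -
  have "\<omega>min \<in> sites" using \<omega>_less by simp
  then have "p * s y (\<omega>min + 1) * f y \<noteq> 0"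
    using rp_zero_iff[of y \<omega>min] rp_eq[of y \<omega>min] assms \<omega>_less by auto
  with f_nonneg[OF assms(1)] show ?thesis by auto
qed

lemma q_pos: "0 < q"
proof -
  have "\<omega>min \<in> sites" "\<omega>max \<in> sites" using \<omega>_less by auto
  then have "q * s (\<omega>min + 1) \<omega>max * f \<omega>max \<noteq> 0"
    using rq_zero_iff[of \<omega>min \<omega>max] rq_eq[of \<omega>min \<omega>max] \<omega>_less by auto
  then show ?thesis using asymmetry by auto
qed

lemma p_pos: "0 < p" and q_less_p: "q < p"
  using asymmetry by auto

lemma f_fact_pos: "y \<in> sites \<Longrightarrow> 0 < f_fact f y"
  unfolding f_fact_def using range by (auto intro!: prod_pos f_pos divide_pos_pos)

lemma f_fact_rec:
  assumes "y \<in> sites" "y \<noteq> \<omega>min"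
  shows "f_fact f y = f y * f_fact f (y - 1)"
proof -
  have nz: "f y \<noteq> 0" using f_pos[OF assms] by simp
  consider "1 < y" | "y = 1" | "y = 0" | "y < 0" by linarith
  then show ?thesis
  proof cases
    case 1
    then have "{1..y} = insert y {1..y - 1}" by auto
    with 1 show ?thesis by (simp add: f_fact_def)
  next
    case 4
    then have "{y..0} = insert y {y + 1..0}" by auto
    with 4 nz show ?thesis by (simp add: f_fact_def)
  qed (use nz in \<open>auto simp: f_fact_def\<close>)
qed

definition site_prob :: "real \<Rightarrow> int \<Rightarrow> int \<Rightarrow> real" where
  "site_prob c i y = 1 / Z_norm \<omega>min \<omega>max f (\<theta>_site p q c i) *
     (exp (\<theta>_site p q c i * of_int y) / f_fact f y)"

lemma Z_norm_pos: "0 < Z_norm \<omega>min \<omega>max f \<theta>"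
  unfolding Z_norm_def using \<omega>_less by (intro sum_pos) (auto intro!: divide_pos_pos f_fact_pos)

lemma site_prob_pos: "y \<in> sites \<Longrightarrow> 0 < site_prob c i y"
  unfolding site_prob_def by (intro mult_pos_pos divide_pos_pos f_fact_pos Z_norm_pos) auto

lemma site_prob_sum: "(\<Sum>y\<in>sites. site_prob c i y) = 1"
  unfolding site_prob_def sum_distrib_left[symmetric] Z_norm_def[symmetric]
  using Z_norm_pos[of "\<theta>_site p q c i"] by simp

lemma site_prob_le_1: "y \<in> sites \<Longrightarrow> site_prob c i y \<le> 1"
  using member_le_sum[of y sites "site_prob c i"] site_prob_pos[of _ c i]
  by (auto simp: site_prob_sum less_imp_le)

lemma site_prob_rec:
  assumes "y \<in> sites" "y \<noteq> \<omega>min"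
  shows "site_prob c i y * f y = exp (\<theta>_site p q c i) * site_prob c i (y - 1)"
proof -
  have "exp (\<theta>_site p q c i * of_int y) = exp (\<theta>_site p q c i) * exp (\<theta>_site p q c i * of_int (y - 1))"
    by (simp add: exp_add[symmetric] algebra_simps)
  then show ?thesis
    using f_pos[OF assms] unfolding site_prob_def f_fact_rec[OF assms] by simp
qed

text \<open>This identity determines the increment \<open>ln p - ln q\<close> of the parameter from site to site.\<close>

lemma tilt_shift: "q * exp (\<theta>_site p q c (i + 1)) = p * exp (\<theta>_site p q c i)"
proof -
  have "\<theta>_site p q c (i + 1) = \<theta>_site p q c i + (ln p - ln q)"
    by (simp add: \<theta>_site_def algebra_simps)
  then have "exp (\<theta>_site p q c (i + 1)) = exp (\<theta>_site p q c i) * (p / q)"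
    using p_pos q_pos by (simp add: exp_add exp_diff)
  then show ?thesis
    using q_pos by simp
qed

text \<open>Both rates contain the same value of \<open>s\<close>.  The factors \<open>f\<close> lower the arguments of the marginals
  at the two sites at the price of \<open>exp \<theta>\<close>, and \<open>tilt_shift\<close> matches these prices with \<open>p\<close> and \<open>q\<close>.\<close>

lemma bond_balance:
  assumes y: "y \<in> sites" "y \<noteq> \<omega>min" and z: "z \<in> sites" "z \<noteq> \<omega>max"
  shows "site_prob c i y * site_prob c (i + 1) z * rp y z
    = site_prob c i (y - 1) * site_prob c (i + 1) (z + 1) * rq (y - 1) (z + 1)"
proof -
  have z': "z + 1 \<in> sites" "z + 1 \<noteq> \<omega>min" and y': "y - 1 \<in> sites"
    using y z by auto
  have "site_prob c i y * site_prob c (i + 1) z * rp y z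
      = (site_prob c i y * f y) * site_prob c (i + 1) z * p * s y (z + 1)"
    by (simp add: rp_eq[OF y(1) z(1)])
  also have "\<dots> = p * exp (\<theta>_site p q c i) * site_prob c i (y - 1) * site_prob c (i + 1) z * s y (z + 1)"
    by (simp add: site_prob_rec[OF y])
  also have "\<dots> = q * s y (z + 1) * site_prob c i (y - 1) * (exp (\<theta>_site p q c (i + 1)) * site_prob c (i + 1) z)"
    by (simp add: tilt_shift[symmetric])
  also have "\<dots> = q * s y (z + 1) * site_prob c i (y - 1) * (site_prob c (i + 1) (z + 1) * f (z + 1))"
    by (simp add: site_prob_rec[OF z'])
  also have "\<dots> = site_prob c i (y - 1) * site_prob c (i + 1) (z + 1) * rq (y - 1) (z + 1)"
    by (simp add: rq_eq[OF y' z'(1)])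
  finally show ?thesis .
qed

lemma prob_space_site: "prob_space (\<mu>_site \<omega>min \<omega>max f (\<theta>_site p q c i))"
proof -
  have "\<mu>_site \<omega>min \<omega>max f (\<theta>_site p q c i) = point_measure sites (\<lambda>y. ennreal (site_prob c i y))"
    by (simp add: \<mu>_site_def site_prob_def)
  also have "prob_space \<dots>"
  proof (rule prob_space_point_measure)
    have "(\<Sum>y\<in>sites. ennreal (site_prob c i y)) = ennreal (\<Sum>y\<in>sites. site_prob c i y)"
      by (intro sum_ennreal less_imp_le site_prob_pos)
    then show "(\<Sum>y\<in>sites. ennreal (site_prob c i y)) = 1"
      by (simp add: site_prob_sum)
  qed auto
  finally show ?thesis .
qed

lemma emeasure_site:
  "y \<in> sites \<Longrightarrow> emeasure (\<mu>_site \<omega>min \<omega>max f (\<theta>_site p q c i)) {y} = ennreal (site_prob c i y)"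
  by (simp add: \<mu>_site_def site_prob_def emeasure_point_measure_finite)

lemma prob_space_\<mu>_prod: "prob_space (\<mu>_prod \<omega>min \<omega>max p q f c)"
  unfolding \<mu>_prod_def by (intro prob_space_PiM prob_space_site)

text \<open>A configuration is the intersection of the cylinders that fix its values in growing boxes.\<close>

lemma emeasure_\<mu>_prod_singleton:
  assumes z: "\<And>i. z i \<in> sites"
  shows "{z} \<in> sets (\<mu>_prod \<omega>min \<omega>max p q f c)"
    and "(\<lambda>n. ennreal (\<Prod>i\<in>{- int n..int n}. site_prob c i (z i)))
      \<longlonglongrightarrow> emeasure (\<mu>_prod \<omega>min \<omega>max p q f c) {z}"
proof -
  let ?M = "\<lambda>i. \<mu>_site \<omega>min \<omega>max f (\<theta>_site p q c i)"
  let ?B = "\<lambda>n. {- int n..int n}"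
  define A where "A n = prod_emb UNIV ?M (?B n) (\<Pi>\<^sub>E i\<in>?B n. {z i})" for n
  have site: "{z i} \<in> sets (?M i)" for i
    using z by (simp add: \<mu>_site_def sets_point_measure)
  have A_sets: "A n \<in> sets (\<mu>_prod \<omega>min \<omega>max p q f c)" for n
    unfolding A_def \<mu>_prod_def using site by (intro sets_PiM_I) auto
  have A_eq: "A n = {x. (\<forall>i. x i \<in> sites) \<and> (\<forall>i\<in>?B n. x i = z i)}" for n
    unfolding A_def prod_emb_def
    by (auto simp: space_point_measure \<mu>_site_def restrict_PiE_iff PiE_iff space_PiM)
  have B: "\<exists>n. i \<in> ?B n" for i
    by (rule exI[of _ "nat \<bar>i\<bar>"]) (simp, linarith)
  have INT: "(\<Inter>n. A n) = {z}"
  proof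
    show "(\<Inter>n. A n) \<subseteq> {z}"
    proof
      fix x assume "x \<in> (\<Inter>n. A n)"
      then have "x i = z i" for i
        using B[of i] unfolding A_eq by blast
      then show "x \<in> {z}" by auto
    qed
  qed (use z in \<open>auto simp: A_eq\<close>)
  show "{z} \<in> sets (\<mu>_prod \<omega>min \<omega>max p q f c)"
    unfolding INT[symmetric] using A_sets by (intro sets.countable_INT) auto
  have emeasure_A: "emeasure (\<mu>_prod \<omega>min \<omega>max p q f c) (A n)
      = ennreal (\<Prod>i\<in>?B n. site_prob c i (z i))" for n
  proof -
    have "emeasure (\<mu>_prod \<omega>min \<omega>max p q f c) (A n) = (\<Prod>i\<in>?B n. emeasure (?M i) {z i})"
      unfolding A_def \<mu>_prod_def using site by (intro emeasure_PiM_emb prob_space_site) auto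
    also have "\<dots> = (\<Prod>i\<in>?B n. ennreal (site_prob c i (z i)))"
      using z by (intro prod.cong refl emeasure_site)
    also have "\<dots> = ennreal (\<Prod>i\<in>?B n. site_prob c i (z i))"
      using z by (intro prod_ennreal) (auto intro!: less_imp_le site_prob_pos)
    finally show ?thesis .
  qed
  have "(\<lambda>n. emeasure (\<mu>_prod \<omega>min \<omega>max p q f c) (A n))
      \<longlonglongrightarrow> emeasure (\<mu>_prod \<omega>min \<omega>max p q f c) (\<Inter>n. A n)"
  proof (rule Lim_emeasure_decseq)
    show "decseq A"
      by (auto simp: decseq_def A_eq)
    interpret prob_space "\<mu>_prod \<omega>min \<omega>max p q f c" by (rule prob_space_\<mu>_prod)
    show "emeasure (\<mu>_prod \<omega>min \<omega>max p q f c) (A n) \<noteq> \<infinity>" for n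
      by simp
  qed (use A_sets in auto)
  then show "(\<lambda>n. ennreal (\<Prod>i\<in>{- int n..int n}. site_prob c i (z i)))
      \<longlonglongrightarrow> emeasure (\<mu>_prod \<omega>min \<omega>max p q f c) {z}"
    by (simp add: emeasure_A INT)
qed

text \<open>In every box that contains the bond, the weights of the two configurations differ only in
  the two factors of \<open>bond_balance\<close>; the identity survives the limit.\<close>

lemma balance_right_jump:
  assumes z: "\<And>i. z i \<in> sites" and i: "z i \<noteq> \<omega>min" "z (i + 1) \<noteq> \<omega>max"
  defines "z' \<equiv> move i (i + 1) z"
  shows "emeasure (\<mu>_prod \<omega>min \<omega>max p q f c) {z} * ennreal (rate z z')
    = emeasure (\<mu>_prod \<omega>min \<omega>max p q f c) {z'} * ennreal (rate z' z)"
proof -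
  have z': "z' j \<in> sites" for j
    using z[of j] i by (auto simp: z'_def move_def)
  have vals: "z' i = z i - 1" "z' (i + 1) = z (i + 1) + 1"
    by (auto simp: z'_def move_def)
  have "z = move (i + 1) i z'"
    by (auto simp: z'_def move_def fun_eq_iff)
  then have bwd: "rate z' z = rq (z i - 1) (z (i + 1) + 1)"
    using rate_left[of z' i] by (simp add: vals)
  have fwd: "rate z z' = rp (z i) (z (i + 1))"
    by (simp add: z'_def rate_right)
  let ?W = "\<lambda>x n. \<Prod>j\<in>{- int n..int n}. site_prob c j (x j)"
  have fin: "?W z n * rate z z' = ?W z' n * rate z' z" if n: "\<bar>i\<bar> + 1 \<le> int n" for n
  proof -
    have split: "?W x n = site_prob c i (x i) * (site_prob c (i + 1) (x (i + 1)) *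
        (\<Prod>j\<in>{- int n..int n} - {i} - {i + 1}. site_prob c j (x j)))" for x
    proof -
      have "i \<in> {- int n..int n}" "i + 1 \<in> {- int n..int n} - {i}"
        using n by (simp, linarith)+
      then show ?thesis
        using prod.remove[of "{- int n..int n}" i "\<lambda>j. site_prob c j (x j)"]
          prod.remove[of "{- int n..int n} - {i}" "i + 1" "\<lambda>j. site_prob c j (x j)"]
        by simp
    qed
    have rest: "(\<Prod>j\<in>{- int n..int n} - {i} - {i + 1}. site_prob c j (z' j))
        = (\<Prod>j\<in>{- int n..int n} - {i} - {i + 1}. site_prob c j (z j))"
      by (intro prod.cong) (auto simp: z'_def move_def)
    show ?thesis
      unfolding split rest fwd bwd vals using bond_balance[OF z i(1) z i(2), of c i]
      by (simp add: mult_ac)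
  qed
  interpret M: prob_space "\<mu>_prod \<omega>min \<omega>max p q f c" by (rule prob_space_\<mu>_prod)
  have lim: "(\<lambda>n. ennreal (?W x n) * ennreal (rate x y))
      \<longlonglongrightarrow> emeasure (\<mu>_prod \<omega>min \<omega>max p q f c) {x} * ennreal (rate x y)"
    if "\<And>j. x j \<in> sites" for x y
    using emeasure_\<mu>_prod_singleton(2)[of x, OF that]
    by (intro tendsto_mult_ennreal tendsto_const) auto
  have "eventually (\<lambda>n. ennreal (?W z n) * ennreal (rate z z') = ennreal (?W z' n) * ennreal (rate z' z)) sequentially"
    using eventually_ge_at_top[of "nat (\<bar>i\<bar> + 1)"]
  proof eventually_elim
    case (elim n)
    then have n: "\<bar>i\<bar> + 1 \<le> int n" by simp
    have "ennreal (?W x n) * ennreal (rate x y) = ennreal (?W x n * rate x y)"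
      if "\<And>j. x j \<in> sites" for x y
      using that by (intro ennreal_mult[symmetric] prod_nonneg rate_bounds)
        (auto intro!: less_imp_le site_prob_pos)
    then show ?case
      using z z' fin[OF n] by simp
  qed
  with lim[of z z', OF z] have "(\<lambda>n. ennreal (?W z' n) * ennreal (rate z' z))
      \<longlonglongrightarrow> emeasure (\<mu>_prod \<omega>min \<omega>max p q f c) {z} * ennreal (rate z z')"
    by (rule Lim_transform_eventually)
  then show ?thesis
    using lim[of z' z, OF z'] by (rule LIMSEQ_unique)
qed

lemma detailed_balance_level:
  assumes x: "x \<in> level n" and y: "y \<in> level n"
  shows "emeasure (\<mu>_prod \<omega>min \<omega>max p q f c) {x} * ennreal (rate x y)
    = emeasure (\<mu>_prod \<omega>min \<omega>max p q f c) {y} * ennreal (rate y x)"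
proof -
  have bal: "emeasure (\<mu>_prod \<omega>min \<omega>max p q f c) {x} * ennreal (rate x y)
    = emeasure (\<mu>_prod \<omega>min \<omega>max p q f c) {y} * ennreal (rate y x)"
    if x: "x \<in> level n" and "y \<in> level n" and "rate x y \<noteq> 0" for x y
    using that(3) level_range[OF x]
  proof (cases rule: rate_cases)
    case (right i)
    show ?thesis
      unfolding right(1) by (rule balance_right_jump[OF level_range[OF x] right(2,3)])
  next
    case (left i)
    have x_eq: "move i (i + 1) y = x"
      unfolding left(1) by (auto simp: move_def fun_eq_iff)
    have "y i \<noteq> \<omega>min" "y (i + 1) \<noteq> \<omega>max"
      unfolding left(1)
      using left(2,3) level_range[OF x, of i] level_range[OF x, of "i + 1"] by (auto simp: move_def)
    then show ?thesis
      using balance_right_jump[where z = y and i = i and c = c, OF level_range[OF \<open>y \<in> level n\<close>]] unfolding x_eq by metis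
  qed
  consider "rate x y \<noteq> 0" | "rate y x \<noteq> 0" | "rate x y = 0" "rate y x = 0"
    by blast
  then show ?thesis
  proof cases
    case 1
    then show ?thesis by (rule bal[OF x y])
  next
    case 2
    then show ?thesis by (rule bal[OF y x, symmetric])
  qed simp
qed

section \<open>The conditioned measure\<close>

text \<open>The ratio of the probability of \<open>y\<close> to that of \<open>step i\<close> is \<open>exp (\<theta> * (y - step i))\<close> up to a
  bounded factor.  To the right \<open>\<theta>\<close> grows linearly in \<open>i\<close> while \<open>y < \<omega>max\<close>; to the left the signs
  are reversed.\<close>

lemma site_prob_decay:
  "\<exists>C\<ge>0. \<forall>i. 1 - site_prob c i (step i) \<le> C * exp (- (ln p - ln q) * \<bar>of_int i\<bar>)"
proof -
  let ?k = "ln p - ln q"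
  \<comment> \<open>\<open>W\<close> bounds \<open>\<bar>y - step i\<bar>\<close>, and \<open>F\<close> bounds all quotients of factorials; the part of the
    exponent that does not depend on \<open>i\<close> is at most \<open>\<bar>c\<bar> * W\<close>\<close>
  define W where "W = real_of_int (\<omega>max - \<omega>min)"
  define F where "F = (\<Sum>a\<in>sites. \<Sum>b\<in>sites. f_fact f a / f_fact f b)"
  define C where "C = (\<Sum>y\<in>sites. exp (\<bar>c\<bar> * W) * F)"
  have k: "0 < ?k"
    using p_pos q_pos q_less_p by simp
  have ratio: "0 \<le> f_fact f a / f_fact f b" if "a \<in> sites" "b \<in> sites" for a b
    using f_fact_pos[OF that(1)] f_fact_pos[OF that(2)] by simp
  have F: "f_fact f a / f_fact f b \<le> F" if "a \<in> sites" "b \<in> sites" for a b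
  proof -
    have "f_fact f a / f_fact f b \<le> (\<Sum>b\<in>sites. f_fact f a / f_fact f b)"
      using that ratio by (intro member_le_sum[of b sites "\<lambda>b. f_fact f a / f_fact f b"]) auto
    also have "\<dots> \<le> F"
      unfolding F_def using that ratio
      by (intro member_le_sum[of a sites "\<lambda>a. \<Sum>b\<in>sites. f_fact f a / f_fact f b"] sum_nonneg) auto
    finally show ?thesis .
  qed
  have F0: "0 \<le> F"
    unfolding F_def by (intro sum_nonneg ratio)
  have other: "site_prob c i y \<le> exp (\<bar>c\<bar> * W) * F * exp (- ?k * \<bar>of_int i\<bar>)"
    if y: "y \<in> sites" "y \<noteq> step i" for i y
  proof -
    have st: "step i \<in> sites"
      using \<omega>_less by (auto simp: step_def)
    let ?h = "real_of_int (y - step i)"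
    have h: "\<bar>?h\<bar> \<le> W"
      using y(1) st by (auto simp: W_def)
    \<comment> \<open>\<open>y - step i\<close> is a nonzero integer of sign opposite to \<open>i\<close>\<close>
    have "i * (y - step i) \<le> - \<bar>i\<bar>"
    proof (cases "i \<le> 0")
      case True
      then have "i * (y - step i) \<le> i * 1"
        using y by (intro mult_left_mono_neg) (auto simp: step_def)
      then show ?thesis using True by simp
    next
      case False
      then have "i * (y - step i) \<le> i * (- 1)"
        using y by (intro mult_left_mono) (auto simp: step_def)
      then show ?thesis using False by simp
    qed
    then have "real_of_int (i * (y - step i)) \<le> real_of_int (- \<bar>i\<bar>)"
      by (simp only: of_int_le_iff)
    then have ih: "real_of_int i * ?h \<le> - \<bar>of_int i\<bar>"
      by simp
    have "\<theta>_site p q c i * ?h = c * ?h + ?k * (of_int i * ?h)"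
      by (simp add: \<theta>_site_def algebra_simps)
    also have "\<dots> \<le> \<bar>c\<bar> * W + ?k * (- \<bar>of_int i\<bar>)"
    proof (intro add_mono mult_left_mono ih)
      have "c * ?h \<le> \<bar>c * ?h\<bar>" by simp
      also have "\<dots> \<le> \<bar>c\<bar> * W"
        unfolding abs_mult using h by (intro mult_left_mono) auto
      finally show "c * ?h \<le> \<bar>c\<bar> * W" .
    qed (use k in simp)
    finally have "exp (\<theta>_site p q c i * ?h) \<le> exp (\<bar>c\<bar> * W + ?k * (- \<bar>of_int i\<bar>))"
      by (simp only: exp_le_cancel_iff)
    also have "\<dots> = exp (\<bar>c\<bar> * W) * exp (- ?k * \<bar>of_int i\<bar>)"
      by (simp only: exp_add mult_minus_right mult_minus_left)
    finally have "exp (\<theta>_site p q c i * ?h) \<le> exp (\<bar>c\<bar> * W) * exp (- ?k * \<bar>of_int i\<bar>)" .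
    then have "exp (\<theta>_site p q c i * ?h) * (f_fact f (step i) / f_fact f y)
        \<le> (exp (\<bar>c\<bar> * W) * exp (- ?k * \<bar>of_int i\<bar>)) * F"
      using F[OF st y(1)] ratio[OF st y(1)] by (intro mult_mono) auto
    moreover have "site_prob c i y = site_prob c i (step i) *
        (exp (\<theta>_site p q c i * ?h) * (f_fact f (step i) / f_fact f y))"
    proof -
      have "exp (\<theta>_site p q c i * of_int y) = exp (\<theta>_site p q c i * of_int (step i)) * exp (\<theta>_site p q c i * ?h)"
        by (simp add: exp_add[symmetric] algebra_simps)
      then show ?thesis
        using f_fact_pos[OF st] by (simp add: site_prob_def)
    qed
    moreover have "\<dots> \<le> 1 * (exp (\<theta>_site p q c i * ?h) * (f_fact f (step i) / f_fact f y))"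
      by (intro mult_right_mono mult_nonneg_nonneg exp_ge_zero site_prob_le_1[OF st] ratio[OF st y(1)])
    ultimately show ?thesis
      by (simp add: mult_ac)
  qed
  have "1 - site_prob c i (step i) \<le> C * exp (- ?k * \<bar>of_int i\<bar>)" for i
  proof -
    have st: "step i \<in> sites"
      using \<omega>_less by (auto simp: step_def)
    have "1 - site_prob c i (step i) = (\<Sum>y\<in>sites - {step i}. site_prob c i y)"
      using sum.remove[OF _ st, of "site_prob c i"] by (simp add: site_prob_sum)
    also have "\<dots> \<le> (\<Sum>y\<in>sites - {step i}. exp (\<bar>c\<bar> * W) * F * exp (- ?k * \<bar>of_int i\<bar>))"
      by (intro sum_mono other) auto
    also have "\<dots> \<le> (\<Sum>y\<in>sites. exp (\<bar>c\<bar> * W) * F * exp (- ?k * \<bar>of_int i\<bar>))"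
      using F0 by (intro sum_mono2) auto
    also have "\<dots> = C * exp (- ?k * \<bar>of_int i\<bar>)"
      by (simp add: C_def)
    finally show ?thesis .
  qed
  moreover have "0 \<le> C"
    unfolding C_def using F0 by (intro sum_nonneg) auto
  ultimately show ?thesis by blast
qed

text \<open>Outside a finite box the configuration is the step, so by \<open>site_prob_decay\<close> the factors of the
  infinite product tend to 1 summably fast.  Grouping the factors in pairs of opposite sites
  makes it a product over the natural numbers.\<close>

lemma \<mu>_prod_singleton_pos:
  assumes z: "z \<in> level n"
  shows "0 < emeasure (\<mu>_prod \<omega>min \<omega>max p q f c) {z}"
proof -
  define w where "w i = site_prob c i (z i)" for i
  define a where "a k = w (int (Suc k)) * w (- int (Suc k))" for k
  define x where "x = exp (- (ln p - ln q))"
  have x: "0 < x" "x < 1"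
    using p_pos q_pos q_less_p by (auto simp: x_def)
  have w: "0 < w i" "w i \<le> 1" for i
    unfolding w_def using level_range[OF z] by (auto intro: site_prob_pos site_prob_le_1)
  have a_pos: "0 < a k" for k
    unfolding a_def using w by simp
  obtain C where C: "0 \<le> C" "\<And>i. 1 - site_prob c i (step i) \<le> C * exp (- (ln p - ln q) * \<bar>of_int i\<bar>)"
    using site_prob_decay by blast
  obtain K where K: "\<And>i. i \<in> defects z \<Longrightarrow> \<bar>i\<bar> \<le> int K"
  proof -
    have "\<bar>i\<bar> \<le> int (nat (\<Sum>j\<in>defects z. \<bar>j\<bar>))" if "i \<in> defects z" for i
      using member_le_sum[OF that, of abs] finite_defects[OF z] by (simp add: sum_nonneg)
    then show ?thesis using that by blast
  qed
  have close: "norm (a k - 1) \<le> 2 * C * x * x ^ k" if "K \<le> k" for k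
  proof -
    have far: "1 - w i \<le> C * x ^ Suc k" if "\<bar>i\<bar> = int (Suc k)" for i
    proof -
      have "i \<notin> defects z"
        using K[of i] that \<open>K \<le> k\<close> by auto
      then have "w i = site_prob c i (step i)"
        by (auto simp: w_def defects_def)
      moreover have "exp (- (ln p - ln q) * \<bar>of_int i\<bar>) = x ^ Suc k"
      proof -
        have "\<bar>real_of_int i\<bar> = real (Suc k)"
          using that by linarith
        then show ?thesis
          unfolding x_def by (subst exp_of_nat_mult[symmetric]) (simp add: mult.commute)
      qed
      ultimately show ?thesis
        using C(2)[of i] by simp
    qed
    have "a k \<le> 1"
      unfolding a_def using w mult_le_one[of "w (int (Suc k))" "w (- int (Suc k))"] by (simp add: less_imp_le)
    then have "norm (a k - 1) = 1 - a k"
      by simp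
    also have "\<dots> \<le> (1 - w (int (Suc k))) + (1 - w (- int (Suc k)))"
    proof -
      have "0 \<le> (1 - w (int (Suc k))) * (1 - w (- int (Suc k)))"
        using w by (intro mult_nonneg_nonneg) auto
      then show ?thesis by (simp add: a_def algebra_simps)
    qed
    also have "\<dots> \<le> C * x ^ Suc k + C * x ^ Suc k"
      by (intro add_mono far) auto
    finally show ?thesis by (simp add: algebra_simps)
  qed
  have "summable (\<lambda>k. norm (a k - 1))"
  proof (rule summable_comparison_test'[where N = K])
    show "summable (\<lambda>k. 2 * C * x * x ^ k)"
      using x by (intro summable_mult summable_geometric) simp
    show "norm (norm (a k - 1)) \<le> 2 * C * x * x ^ k" if "K \<le> k" for k
      using close[OF that] by (simp only: real_norm_def abs_abs abs_idempotent)
  qed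
  then have "convergent_prod a"
    by (intro abs_convergent_prod_imp_convergent_prod summable_imp_abs_convergent_prod)
  moreover have "a k \<noteq> 0" for k
    using a_pos[of k] by simp
  ultimately obtain L where L: "(\<lambda>m. \<Prod>k\<le>m. a k) \<longlonglongrightarrow> L" "L \<noteq> 0"
    using convergent_prod_iff_nz_lim[of a] by blast
  have "0 \<le> L"
    by (rule LIMSEQ_le_const[OF L(1)]) (intro exI allI impI prod_nonneg less_imp_le a_pos)
  have W: "(\<Prod>i\<in>{- int (Suc m)..int (Suc m)}. w i) = w 0 * (\<Prod>k\<le>m. a k)" for m
  proof (induction m)
    case 0
    have "{- int (Suc 0)..int (Suc 0)} = {-1, 0, 1}" by auto
    then show ?case by (simp add: a_def)
  next
    case (Suc m)
    have "{- int (Suc (Suc m))..int (Suc (Suc m))}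
        = insert (int (Suc (Suc m))) (insert (- int (Suc (Suc m))) {- int (Suc m)..int (Suc m)})"
      by auto
    then have "(\<Prod>i\<in>{- int (Suc (Suc m))..int (Suc (Suc m))}. w i)
        = w (int (Suc (Suc m))) * (w (- int (Suc (Suc m))) * (\<Prod>i\<in>{- int (Suc m)..int (Suc m)}. w i))"
      by (simp del: of_nat_Suc)
    then show ?case
      unfolding Suc.IH by (simp add: a_def mult_ac)
  qed
  have "(\<lambda>m. w 0 * (\<Prod>k\<le>m. a k)) \<longlonglongrightarrow> w 0 * L"
    by (intro tendsto_mult tendsto_const L(1))
  then have "(\<lambda>m. ennreal (\<Prod>i\<in>{- int (Suc m)..int (Suc m)}. w i)) \<longlonglongrightarrow> ennreal (w 0 * L)"
    unfolding W by (rule tendsto_ennrealI)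
  moreover have "(\<lambda>m. ennreal (\<Prod>i\<in>{- int (Suc m)..int (Suc m)}. w i))
      \<longlonglongrightarrow> emeasure (\<mu>_prod \<omega>min \<omega>max p q f c) {z}"
    unfolding w_def
    by (rule LIMSEQ_Suc[OF emeasure_\<mu>_prod_singleton(2)[of z, OF level_range[OF z]]])
  ultimately have "emeasure (\<mu>_prod \<omega>min \<omega>max p q f c) {z} = ennreal (w 0 * L)"
    using LIMSEQ_unique by blast
  then show ?thesis
    using w(1)[of 0] \<open>L \<noteq> 0\<close> \<open>0 \<le> L\<close> by simp
qed

text \<open>Every level contains a configuration, whose weight is positive; hence the conditioning is
  on an event of positive probability.\<close>

lemma \<nu>_facts:
  shows "prob_space (\<nu> \<omega>min \<omega>max p q f c n)"
    and "sets (\<nu> \<omega>min \<omega>max p q f c n) = Pow (level n)"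
    and "z \<in> level n \<Longrightarrow> emeasure (\<nu> \<omega>min \<omega>max p q f c n) {z}
      = emeasure (\<mu>_prod \<omega>min \<omega>max p q f c) {z} / emeasure (\<mu>_prod \<omega>min \<omega>max p q f c) (level n)"
proof -
  let ?M = "\<mu>_prod \<omega>min \<omega>max p q f c"
  interpret M: prob_space ?M by (rule prob_space_\<mu>_prod)
  have single: "{z} \<in> sets ?M" if "z \<in> level n" for z
    using emeasure_\<mu>_prod_singleton(1)[of z] level_range[OF that] by blast
  have subs: "X \<in> sets ?M" if "X \<subseteq> level n" for X
    using that by (intro sets.countable[OF _ countable_subset[OF that countable_level]] single) auto
  obtain z0 where z0: "z0 \<in> level n"
    using level_nonempty by blast
  have "0 < emeasure ?M {z0}"
    by (rule \<mu>_prod_singleton_pos[OF z0])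
  also have "\<dots> \<le> emeasure ?M (level n)"
    using z0 by (intro emeasure_mono subs) auto
  finally have nz: "emeasure ?M (level n) \<noteq> 0"
    by simp
  let ?U = "uniform_measure ?M (level n)"
  show sets: "sets (\<nu> \<omega>min \<omega>max p q f c n) = Pow (level n)"
  proof
    show "Pow (level n) \<subseteq> sets (\<nu> \<omega>min \<omega>max p q f c n)"
      unfolding \<nu>_def sets_restrict_space sets_uniform_measure
      by (auto simp: image_iff intro!: bexI[OF _ subs])
  qed (auto simp: \<nu>_def sets_restrict_space)
  have level_sets: "level n \<in> sets ?M"
    by (rule subs) simp
  have U1: "emeasure ?U (level n) = 1"
    using nz level_sets by (simp add: ennreal_divide_self less_top[symmetric])
  show "prob_space (\<nu> \<omega>min \<omega>max p q f c n)"
    unfolding \<nu>_def using level_sets U1 by (intro prob_space_restrict_space) auto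
  show "emeasure (\<nu> \<omega>min \<omega>max p q f c n) {z} = emeasure ?M {z} / emeasure ?M (level n)"
    if "z \<in> level n"
  proof -
    have "emeasure (\<nu> \<omega>min \<omega>max p q f c n) {z} = emeasure ?U {z}"
      unfolding \<nu>_def using that level_sets sets.sets_into_space[OF level_sets]
      by (intro emeasure_restrict_space) (auto simp: Int_absorb2)
    also have "\<dots> = emeasure ?M (level n \<inter> {z}) / emeasure ?M (level n)"
      by (rule emeasure_uniform_measure[OF level_sets single[OF that]])
    also have "level n \<inter> {z} = {z}"
      using that by auto
    finally show ?thesis .
  qed
qed

lemma \<nu>_trans_balance:
  assumes "x \<in> level n" "y \<in> level n"
  shows "emeasure (\<nu> \<omega>min \<omega>max p q f c n) {x} * ctmc_trans (level n) rate t x y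
    = emeasure (\<nu> \<omega>min \<omega>max p q f c n) {y} * ctmc_trans (level n) rate t y x"
proof -
  interpret countable_chain "level n" rate by (rule level_chain)
  show ?thesis
  proof (rule detailed_balance_trans[OF _ assms])
    show "emeasure (\<nu> \<omega>min \<omega>max p q f c n) {x} * ennreal (rate x y)
        = emeasure (\<nu> \<omega>min \<omega>max p q f c n) {y} * ennreal (rate y x)"
      if "x \<in> level n" "y \<in> level n" for x y
      using detailed_balance_level[OF that, of c]
      by (simp add: \<nu>_facts(3) that divide_ennreal_def mult.assoc mult.commute[of "inverse _"])
         (simp add: mult.assoc[symmetric])
  qed
qed

lemma stationary_distribution_process:
  "stationary_distribution (level n) (process_trans \<omega>min \<omega>max rp rq) \<pi>
    \<longleftrightarrow> stationary_distribution (level n) (ctmc_trans (level n) rate) \<pi>"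
proof -
  have "(\<integral>\<^sup>+x. process_trans \<omega>min \<omega>max rp rq t x y \<partial>\<pi>) = (\<integral>\<^sup>+x. ctmc_trans (level n) rate t x y \<partial>\<pi>)"
    if "sets \<pi> = Pow (level n)" for t y
    using sets_eq_imp_space_eq[of \<pi> "count_space (level n)"] that
    by (intro nn_integral_cong process_trans_level) simp
  then show ?thesis
    unfolding stationary_distribution_def by (intro conj_cong refl) simp
qed

lemma \<nu>_stationary:
  "stationary_distribution (level n) (process_trans \<omega>min \<omega>max rp rq) (\<nu> \<omega>min \<omega>max p q f c n)"
  unfolding stationary_distribution_process
  unfolding stationary_distribution_def
proof (intro conjI \<nu>_facts(1,2) allI impI ballI)
  fix t :: real and y assume t: "0 \<le> t" and y: "y \<in> level n"
  let ?P = "ctmc_trans (level n) rate t" and ?N = "\<nu> \<omega>min \<omega>max p q f c n"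
  have "(\<integral>\<^sup>+x. ?P x y \<partial>?N) = (\<integral>\<^sup>+x. emeasure ?N {x} * ?P x y \<partial>count_space (level n))"
    by (rule nn_integral_countable_measure[OF countable_level \<nu>_facts(2)])
  also have "\<dots> = (\<integral>\<^sup>+x. emeasure ?N {y} * ?P y x \<partial>count_space (level n))"
    using y by (intro nn_integral_cong \<nu>_trans_balance) auto
  also have "\<dots> = emeasure ?N {y}"
    by (simp add: nn_integral_cmult level_honest[OF y t])
  finally show "(\<integral>\<^sup>+x. ?P x y \<partial>?N) = emeasure ?N {y}" .
qed

lemma \<nu>_unique:
  assumes "stationary_distribution (level n) (process_trans \<omega>min \<omega>max rp rq) \<pi>"
  shows "\<pi> = \<nu> \<omega>min \<omega>max p q f c n"
  using assms \<nu>_stationary[of n c] unfolding stationary_distribution_process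
  by (intro stationary_distribution_unique[OF countable_level, of 1])
     (auto intro: level_honest level_trans_pos)

lemma \<nu>_reversible:
  "reversible_distribution (level n) (process_trans \<omega>min \<omega>max rp rq) (\<nu> \<omega>min \<omega>max p q f c n)"
  unfolding reversible_distribution_def
  by (intro conjI \<nu>_facts(1,2) allI impI ballI) (simp add: process_trans_level \<nu>_trans_balance)

end

theorem corollary3p4:
  fixes \<omega>min \<omega>max :: int
    and rp rq :: "int \<Rightarrow> int \<Rightarrow> real"
    and p q c :: real
    and f :: "int \<Rightarrow> real"
    and s :: "int \<Rightarrow> int \<Rightarrow> real"
    and n :: int
  assumes "blocking_model \<omega>min \<omega>max rp rq p q f s"
  shows "stationary_distribution (\<Omega>_level \<omega>min \<omega>max n) (process_trans \<omega>min \<omega>max rp rq)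
           (\<nu> \<omega>min \<omega>max p q f c n)
       \<and> (\<forall>\<pi>. stationary_distribution (\<Omega>_level \<omega>min \<omega>max n) (process_trans \<omega>min \<omega>max rp rq) \<pi>
            \<longrightarrow> \<pi> = \<nu> \<omega>min \<omega>max p q f c n)
       \<and> reversible_distribution (\<Omega>_level \<omega>min \<omega>max n) (process_trans \<omega>min \<omega>max rp rq)
           (\<nu> \<omega>min \<omega>max p q f c n)"
proof -
  interpret blocking_model \<omega>min \<omega>max rp rq p q f s by (rule assms)
  show ?thesis
    using \<nu>_stationary \<nu>_unique \<nu>_reversible by blast
qed

end
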